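(* Let $G$ be a finite group, let $\theta:G\to G$ be an involution, and let $H\subset G$ be a $\theta$-stable subgroup (i.e. $\theta(H)=H$). Then the following are equivalent: (1) $(G,H)$ is a Gelfand pair, and every irreducible $H$-distinguished representation $\pi$ of $G$ satisfies $\pi\circ\theta\cong\pi^*$. (2) For every $g\in G$ there exist $h_1,h_2\in H$ such that $h_1g^{-1}h_2=\theta(g)$.
   Context: All representations are finite-dimensional complex representations. An involution $\theta:G\to G$ is a group automorphism with $\theta\circ\theta=\mathrm{id}_G$. For a representation $\pi$ of $G$, $\pi^H$ denotes the subspace of $H$-invariant vectors, $\pi^*$ the dual (contragredient) representation, and $\pi\circ\theta$ the representation $g\mapsto\pi(\theta(g))$ on the same space. $\pi$ is $H$-distinguished if $\pi^H\neq 0$. $(G,H)$ is a Gelfand pair if $\dim\pi^H\le 1$ for every irreducible representation $\pi$ of $G$. *)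

theory Defs
  imports "Jordan_Normal_Form.VS_Connect"
begin

text \<open>
  Finite-dimensional complex representations are given in coordinates: a representation of degree
  \<open>n\<close> is a homomorphism \<open>G \<rightarrow> GL\<^sub>n(\<complex>)\<close>, acting on the space of column vectors of length \<open>n\<close>.
  Values outside the carrier of \<open>G\<close> are irrelevant.
\<close>

definition GL :: "nat \<Rightarrow> complex mat monoid" where
  "GL n = units_of (ring_mat TYPE(complex) n ())"

definition representation :: "('a, 'b) monoid_scheme \<Rightarrow> nat \<Rightarrow> ('a \<Rightarrow> complex mat) \<Rightarrow> bool" where
  "representation G n \<rho> \<longleftrightarrow> \<rho> \<in> hom G (GL n)"

definition invariant_subspace ::
  "('a, 'b) monoid_scheme \<Rightarrow> nat \<Rightarrow> ('a \<Rightarrow> complex mat) \<Rightarrow> complex vec set \<Rightarrow> bool" where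
  "invariant_subspace G n \<rho> W \<longleftrightarrow>
     VectorSpace.subspace class_ring W (module_vec TYPE(complex) n) \<and>
     (\<forall>g\<in>carrier G. \<forall>w\<in>W. \<rho> g *\<^sub>v w \<in> W)"

definition irreducible_rep :: "('a, 'b) monoid_scheme \<Rightarrow> nat \<Rightarrow> ('a \<Rightarrow> complex mat) \<Rightarrow> bool" where
  "irreducible_rep G n \<rho> \<longleftrightarrow> representation G n \<rho> \<and> n \<noteq> 0 \<and>
     (\<forall>W. invariant_subspace G n \<rho> W \<longrightarrow> W = {0\<^sub>v n} \<or> W = carrier_vec n)"

definition rep_iso ::
  "('a, 'b) monoid_scheme \<Rightarrow> nat \<Rightarrow> ('a \<Rightarrow> complex mat) \<Rightarrow> nat \<Rightarrow> ('a \<Rightarrow> complex mat) \<Rightarrow> bool" where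
  "rep_iso G n \<rho> m \<sigma> \<longleftrightarrow>
     (\<exists>T\<in>carrier_mat m n.
        bij_betw (\<lambda>v. T *\<^sub>v v) (carrier_vec n) (carrier_vec m) \<and>
        (\<forall>g\<in>carrier G. T * \<rho> g = \<sigma> g * T))"

text \<open>
  The contragredient \<open>(g \<cdot> f)(v) = f(\<rho>(g\<^sup>-\<^sup>1) v)\<close>, written in the dual basis: the linear functional
  \<open>f\<close> is identified with the vector of its values on the standard basis, so that \<open>f(v)\<close> becomes the
  bilinear product \<open>f \<bullet> v\<close>. See \<open>dual_rep_pairing\<close> below.
\<close>

definition dual_rep :: "('a, 'b) monoid_scheme \<Rightarrow> ('a \<Rightarrow> complex mat) \<Rightarrow> 'a \<Rightarrow> complex mat" where
  "dual_rep G \<rho> g = transpose_mat (\<rho> (inv\<^bsub>G\<^esub> g))"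

definition invariants :: "'a set \<Rightarrow> nat \<Rightarrow> ('a \<Rightarrow> complex mat) \<Rightarrow> complex vec set" where
  "invariants H n \<rho> = {v \<in> carrier_vec n. \<forall>h\<in>H. \<rho> h *\<^sub>v v = v}"

definition dim_invariants :: "'a set \<Rightarrow> nat \<Rightarrow> ('a \<Rightarrow> complex mat) \<Rightarrow> nat" where
  "dim_invariants H n \<rho> =
     vectorspace.dim class_ring ((module_vec TYPE(complex) n)\<lparr>carrier := invariants H n \<rho>\<rparr>)"

definition distinguished :: "'a set \<Rightarrow> nat \<Rightarrow> ('a \<Rightarrow> complex mat) \<Rightarrow> bool" where
  "distinguished H n \<rho> \<longleftrightarrow> invariants H n \<rho> \<noteq> {0\<^sub>v n}"

definition gelfand_pair :: "('a, 'b) monoid_scheme \<Rightarrow> 'a set \<Rightarrow> bool" where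
  "gelfand_pair G H \<longleftrightarrow> (\<forall>n \<rho>. irreducible_rep G n \<rho> \<longrightarrow> dim_invariants H n \<rho> \<le> 1)"

lemma representation_carrier:
  assumes "representation G n \<rho>" "g \<in> carrier G"
  shows "\<rho> g \<in> carrier_mat n n"
  using assms by (auto simp: representation_def hom_def GL_def units_of_def Units_def ring_mat_def)

lemma dual_rep_pairing:
  assumes "group G" "representation G n \<rho>" "g \<in> carrier G" "f \<in> carrier_vec n" "v \<in> carrier_vec n"
  shows "(dual_rep G \<rho> g *\<^sub>v f) \<bullet> v = f \<bullet> (\<rho> (inv\<^bsub>G\<^esub> g) *\<^sub>v v)"
proof -
  have "\<rho> (inv\<^bsub>G\<^esub> g) \<in> carrier_mat n n"
    using assms representation_carrier group.inv_closed by metis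
  then show ?thesis
    unfolding dual_rep_def using assms(4,5) transpose_vec_mult_scalar by metis
qed

lemma subspace_invariants:
  assumes "group G" "subgroup H G" "representation G n \<rho>"
  shows "VectorSpace.subspace class_ring (invariants H n \<rho>) (module_vec TYPE(complex) n)"
proof -
  interpret vec_space "TYPE(complex)" n .
  have car: "\<rho> h \<in> carrier_mat n n" if "h \<in> H" for h
    using representation_carrier[OF assms(3)] subgroup.mem_carrier[OF assms(2) that] by blast
  have zero: "A *\<^sub>v 0\<^sub>v n = 0\<^sub>v n" if "A \<in> carrier_mat n n" for A :: "complex mat"
    using that by auto
  have "submodule class_ring (invariants H n \<rho>) V"
    unfolding submodule_def
    using mult_add_distrib_mat_vec[OF car] mult_mat_vec[OF car] zero[OF car]
    by (auto simp: invariants_def module_vec_simps intro!: module_axioms)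
  then show ?thesis
    by (simp add: VectorSpace.subspace_def vectorspace_axioms)
qed

end

theory Submission
  imports Defs "Jordan_Normal_Form.Spectral_Radius"
begin

text \<open>
  For a representation \<open>\<rho>\<close> let \<open>e\<close> be the average of \<open>\<rho> h\<close> over \<open>h \<in> H\<close>, the projector onto the
  \<open>H\<close>-invariant vectors. The matrix \<open>e \<rho>(g) e\<close> depends only on the double coset \<open>H g H\<close>. Both conditions
  of the theorem are compared with the property that \<open>e \<rho>(\<theta> g) e = e \<rho>(g\<^sup>-\<^sup>1) e\<close> for all \<open>g\<close>, which is
  called \<open>twist_symmetric\<close> below. It says that the map induced by \<open>g \<mapsto> \<theta>(g\<^sup>-\<^sup>1)\<close>, an anti-automorphism of
  the Hecke algebra of \<open>H\<close> in \<open>G\<close>, becomes the identity in the action on the invariant vectors.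

  The coset condition is equivalent to twist symmetry of all representations. One direction is
  immediate (\<open>double_cosets_imp_twist_symmetric\<close>). For the other one the regular representation
  suffices: there the entries of \<open>e \<rho>(x) e\<close> detect the double coset of \<open>x\<close>
  (\<open>double_cosets_of_regular\<close>). By Maschke's theorem twist symmetry of all representations follows from
  that of the irreducible ones (\<open>twist_symmetric_of_irreducibles\<close>). It remains to see that for one
  irreducible \<open>\<rho>\<close> twist symmetry means exactly that the invariants are at most one-dimensional and that
  \<open>\<rho> \<circ> \<theta>\<close> is isomorphic to the dual of \<open>\<rho>\<close> if there is a nonzero invariant vector.

  If the invariants form a line, then \<open>e \<rho>(g) e = \<phi>(g) e\<close> for a scalar function \<open>\<phi>\<close> (the spherical
  function), and an isomorphism \<open>T\<close> from \<open>\<rho> \<circ> \<theta>\<close> to the dual, which takes \<open>e\<close> to its transpose, gives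
  \<open>\<phi>(\<theta> g) = \<phi>(g\<^sup>-\<^sup>1)\<close> (\<open>twist_symmetric_of_dual\<close>). Conversely, twist symmetry makes the matrices
  \<open>e \<rho>(g) e\<close> commute, since an anti-automorphism that fixes them reverses their products. A common
  eigenvector generates the irreducible space, which forces the range of \<open>e\<close> to be a line
  (\<open>dim_invariants_of_twist_symmetric\<close>). An intertwiner from \<open>\<rho> \<circ> \<theta>\<close> to the dual is obtained by
  averaging; it is nonzero because, by twist symmetry, it is governed by the mean of
  \<open>\<phi>(g) \<phi>(g\<^sup>-\<^sup>1)\<close>, which Schur's lemma and a trace computation show to be nonzero
  (\<open>dual_of_twist_symmetric\<close>).
\<close>

section \<open>Subspaces of \<open>\<complex>\<^sup>n\<close> and common eigenvectors\<close>

abbreviation vec_subspace :: "nat \<Rightarrow> complex vec set \<Rightarrow> bool" where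
  "vec_subspace n W \<equiv> VectorSpace.subspace class_ring W (module_vec TYPE(complex) n)"

lemma vec_subspaceI:
  assumes "W \<subseteq> carrier_vec n" "0\<^sub>v n \<in> W"
    and "\<And>v w. v \<in> W \<Longrightarrow> w \<in> W \<Longrightarrow> v + w \<in> W" "\<And>c v. v \<in> W \<Longrightarrow> c \<cdot>\<^sub>v v \<in> W"
  shows "vec_subspace n W"
proof -
  interpret vec_space "TYPE(complex)" n .
  have "submodule class_ring W V"
    unfolding submodule_def using assms by (auto simp: module_vec_simps intro!: module_axioms)
  then show ?thesis
    by (simp add: VectorSpace.subspace_def vectorspace_axioms)
qed

lemma vec_subspaceD:
  assumes "vec_subspace n W"
  shows "W \<subseteq> carrier_vec n" "0\<^sub>v n \<in> W"
    and "\<And>v w. v \<in> W \<Longrightarrow> w \<in> W \<Longrightarrow> v + w \<in> W" "\<And>c v. v \<in> W \<Longrightarrow> c \<cdot>\<^sub>v v \<in> W"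
  using assms unfolding VectorSpace.subspace_def submodule_def
  by (auto simp: module_vec_simps)

lemma zero_mat_mult_vec:
  fixes v :: "complex vec"
  shows "v \<in> carrier_vec m \<Longrightarrow> 0\<^sub>m n m *\<^sub>v v = 0\<^sub>v n"
  by (auto intro!: eq_vecI)

lemma mat_mult_zero_vec:
  fixes A :: "complex mat"
  shows "A \<in> carrier_mat n m \<Longrightarrow> A *\<^sub>v 0\<^sub>v m = 0\<^sub>v n"
  by (auto intro!: eq_vecI)

text \<open>
  Padding \<open>B\<close> and \<open>C\<close> with zeros to size \<open>r \<times> r\<close> would make them mutually inverse if \<open>r\<close> exceeded
  \<open>n\<close>, although the padded \<open>B\<close> has a zero row.
\<close>

lemma left_inverse_dim_le:
  fixes B C :: "complex mat"
  assumes B: "B \<in> carrier_mat n r" and C: "C \<in> carrier_mat r n" and CB: "C * B = 1\<^sub>m r"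
  shows "r \<le> n"
proof (rule ccontr)
  assume "\<not> r \<le> n"
  then have nr: "n < r" by simp
  define B' where "B' = mat r r (\<lambda>(i,j). if i < n then B $$ (i,j) else 0)"
  define C' where "C' = mat r r (\<lambda>(i,j). if j < n then C $$ (i,j) else 0)"
  have carr: "B' \<in> carrier_mat r r" "C' \<in> carrier_mat r r" by (auto simp: B'_def C'_def)
  have "C' * B' = C * B"
  proof (rule eq_matI)
    fix i j assume "i < dim_row (C * B)" "j < dim_col (C * B)"
    then have ij: "i < r" "j < r" using B C by auto
    have "(C' * B') $$ (i,j) = (\<Sum>k\<in>{0..<r}. C' $$ (i,k) * B' $$ (k,j))"
      using ij carr by (auto simp: scalar_prod_def)
    also have "\<dots> = (\<Sum>k\<in>{0..<n}. C' $$ (i,k) * B' $$ (k,j))"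
      using nr ij by (intro sum.mono_neutral_right) (auto simp: B'_def C'_def)
    also have "\<dots> = (C * B) $$ (i,j)"
      using ij B C nr by (auto simp: scalar_prod_def B'_def C'_def intro!: sum.cong)
    finally show "(C' * B') $$ (i,j) = (C * B) $$ (i,j)" .
  qed (use B C carr in auto)
  then have "B' * C' = 1\<^sub>m r"
    using mat_mult_left_right_inverse[OF carr(2,1)] CB by simp
  moreover have "(B' * C') $$ (n,n) = 0"
    using nr carr by (auto simp: scalar_prod_def B'_def)
  ultimately show False using nr by simp
qed

text \<open>
  Coordinates on a subspace: the columns of \<open>B\<close> are a basis of \<open>W\<close>, and \<open>C\<close> reads off the coordinates,
  so that \<open>B C\<close> is a projection onto \<open>W\<close>. This turns invariant subspaces into representations by
  matrices of smaller size. The pair is found by taking \<open>r\<close> maximal: a vector of \<open>W\<close> that \<open>B C\<close> does not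
  fix would provide one more column for \<open>B\<close> and one more row for \<open>C\<close>.
\<close>

lemma subspace_parametrization:
  assumes W: "vec_subspace n W"
  obtains r B C where "B \<in> carrier_mat n r" "C \<in> carrier_mat r n" "C * B = 1\<^sub>m r"
    "\<And>x. x \<in> carrier_vec r \<Longrightarrow> B *\<^sub>v x \<in> W" "\<And>w. w \<in> W \<Longrightarrow> B *\<^sub>v (C *\<^sub>v w) = w"
proof -
  define P where "P r B C \<longleftrightarrow> B \<in> carrier_mat n r \<and> C \<in> carrier_mat r n \<and> C * B = 1\<^sub>m r \<and>
    (\<forall>x\<in>carrier_vec r. B *\<^sub>v x \<in> W)" for r and B C :: "complex mat"
  note sub = vec_subspaceD[OF W]
  have "P 0 (0\<^sub>m n 0) (0\<^sub>m 0 n)"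
    using sub(2) by (auto simp: P_def zero_mat_mult_vec intro!: eq_matI)
  then have ex: "\<exists>B C. P 0 B C" by blast
  have bound: "\<forall>r. (\<exists>B C. P r B C) \<longrightarrow> r \<le> n"
    using left_inverse_dim_le by (auto simp: P_def)
  obtain r where r: "\<exists>B C. P r B C" and rmax: "\<And>r'. \<exists>B C. P r' B C \<Longrightarrow> r' \<le> r"
    using GreatestI_nat[of "\<lambda>r. \<exists>B C. P r B C" 0 n] Greatest_le_nat[of "\<lambda>r. \<exists>B C. P r B C" _ n]
      ex bound by blast
  then obtain B C where PBC: "P r B C" by blast
  then have B: "B \<in> carrier_mat n r" and C: "C \<in> carrier_mat r n" and CB: "C * B = 1\<^sub>m r"
    and BW: "\<And>x. x \<in> carrier_vec r \<Longrightarrow> B *\<^sub>v x \<in> W"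
    by (auto simp: P_def)
  have "B *\<^sub>v (C *\<^sub>v v) = v" if vW: "v \<in> W" for v
  proof (rule ccontr)
    assume neq: "B *\<^sub>v (C *\<^sub>v v) \<noteq> v"
    have v: "v \<in> carrier_vec n" using sub(1) vW by auto
    define w where "w = v + (-1) \<cdot>\<^sub>v (B *\<^sub>v (C *\<^sub>v v))"
    have BCv: "B *\<^sub>v (C *\<^sub>v v) \<in> W" using BW[of "C *\<^sub>v v"] C v by simp
    have wW: "w \<in> W" unfolding w_def using vW BCv sub(3,4) by blast
    then have w: "w \<in> carrier_vec n" using sub(1) by auto
    have "C *\<^sub>v w = C *\<^sub>v v + (-1) \<cdot>\<^sub>v (C *\<^sub>v (B *\<^sub>v (C *\<^sub>v v)))"
      unfolding w_def using B C v by (simp add: mult_add_distrib_mat_vec mult_mat_vec)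
    also have "C *\<^sub>v (B *\<^sub>v (C *\<^sub>v v)) = C *\<^sub>v v"
      using assoc_mult_mat_vec[OF C B, of "C *\<^sub>v v"] C v CB by simp
    finally have Cw: "C *\<^sub>v w = 0\<^sub>v r"
      using C v by (auto intro!: eq_vecI)
    have "\<exists>i<n. w $ i \<noteq> 0"
    proof (rule ccontr)
      assume "\<not> (\<exists>i<n. w $ i \<noteq> 0)"
      then have "v $ i = (B *\<^sub>v (C *\<^sub>v v)) $ i" if "i < n" for i
        using that v B C by (simp add: w_def del: index_mult_mat_vec)
      then have "v = B *\<^sub>v (C *\<^sub>v v)" using v B by (intro eq_vecI) auto
      with neq show False by simp
    qed
    then obtain i where i: "i < n" "w $ i \<noteq> 0" by blast
    define q where "q = (1 / w $ i) \<cdot>\<^sub>v unit_vec n i"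
    have q: "q \<in> carrier_vec n" by (simp add: q_def)
    have qw: "q \<bullet> w = 1" using i w by (simp add: q_def)
    \<comment> \<open>a linear functional that vanishes on the range of \<open>B\<close> and takes the value 1 at \<open>w\<close>\<close>
    define p where "p = q - C\<^sup>T *\<^sub>v (B\<^sup>T *\<^sub>v q)"
    have p: "p \<in> carrier_vec n" using q B C by (simp add: p_def)
    have p_prod: "p \<bullet> x = q \<bullet> x - (B\<^sup>T *\<^sub>v q) \<bullet> (C *\<^sub>v x)" if "x \<in> carrier_vec n" for x
      using that q B C transpose_vec_mult_scalar[OF C that, of "B\<^sup>T *\<^sub>v q"]
      by (simp add: p_def minus_scalar_prod_distrib)
    have pw: "p \<bullet> w = 1"
      using p_prod[OF w] qw Cw B q by simp
    have pB: "p \<bullet> col B j = 0" if j: "j < r" for j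
    proof -
      have "C *\<^sub>v col B j = col (C * B) j" by (rule col_mult2[OF C B j, symmetric])
      also have "\<dots> = unit_vec r j" using CB j by simp
      finally have "(B\<^sup>T *\<^sub>v q) \<bullet> (C *\<^sub>v col B j) = (B\<^sup>T *\<^sub>v q) $ j"
        using j B q by simp
      also have "\<dots> = q \<bullet> col B j" using j B q by (simp add: comm_scalar_prod[of _ n])
      finally show ?thesis using p_prod[of "col B j"] j B by simp
    qed
    define B' where "B' = mat n (Suc r) (\<lambda>(i,j). if j < r then B $$ (i,j) else w $ i)"
    define C' where "C' = mat (Suc r) n (\<lambda>(i,j). if i < r then C $$ (i,j) else p $ j)"
    have carr: "B' \<in> carrier_mat n (Suc r)" "C' \<in> carrier_mat (Suc r) n"
      by (auto simp: B'_def C'_def)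
    have colB': "col B' j = (if j < r then col B j else w)" if "j < Suc r" for j
      using that B w by (auto simp: B'_def intro!: eq_vecI)
    have rowC': "row C' j = (if j < r then row C j else p)" if "j < Suc r" for j
      using that C p by (auto simp: C'_def intro!: eq_vecI)
    have "C' * B' = 1\<^sub>m (Suc r)"
    proof (rule eq_matI)
      fix i j assume "i < dim_row (1\<^sub>m (Suc r) :: complex mat)" "j < dim_col (1\<^sub>m (Suc r) :: complex mat)"
      then have ij: "i < Suc r" "j < Suc r" by auto
      have e1: "row C i \<bullet> col B j = 1\<^sub>m r $$ (i,j)" if "i < r" "j < r"
        using that B C CB index_mult_mat(1)[of i C j B] by simp
      have e2: "row C i \<bullet> w = 0" if "i < r"
        using that Cw C index_mult_mat_vec[of i C w] by simp
      show "(C' * B') $$ (i,j) = 1\<^sub>m (Suc r) $$ (i,j)"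
        using ij carr colB'[OF ij(2)] rowC'[OF ij(1)] e1 e2 pw pB by auto
    qed (use carr in auto)
    moreover have "B' *\<^sub>v x \<in> W" if x: "x \<in> carrier_vec (Suc r)" for x
    proof -
      have "B' *\<^sub>v x = B *\<^sub>v vec_first x r + x $ r \<cdot>\<^sub>v w"
        using x B w
        by (auto intro!: eq_vecI simp: B'_def scalar_prod_def vec_first_def)
      then show ?thesis using BW[of "vec_first x r"] wW sub(3,4) by simp
    qed
    ultimately have "P (Suc r) B' C'" using carr by (simp add: P_def)
    then show False using rmax[of "Suc r"] by auto
  qed
  then show thesis using that B C CB BW by blast
qed

lemma eigenvector_in_subspace:
  assumes W: "vec_subspace n W" and ne: "W \<noteq> {0\<^sub>v n}"
    and A: "A \<in> carrier_mat n n" and AW: "\<And>w. w \<in> W \<Longrightarrow> A *\<^sub>v w \<in> W"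
  obtains c w where "w \<in> W" "w \<noteq> 0\<^sub>v n" "A *\<^sub>v w = c \<cdot>\<^sub>v w"
proof -
  obtain r B C where B: "B \<in> carrier_mat n r" and C: "C \<in> carrier_mat r n" and CB: "C * B = 1\<^sub>m r"
    and BW: "\<And>x. x \<in> carrier_vec r \<Longrightarrow> B *\<^sub>v x \<in> W" and BC: "\<And>w. w \<in> W \<Longrightarrow> B *\<^sub>v (C *\<^sub>v w) = w"
    by (rule subspace_parametrization[OF W]) blast
  note sub = vec_subspaceD[OF W]
  have "r > 0"
  proof (rule ccontr)
    assume "\<not> r > 0"
    then have "B *\<^sub>v (C *\<^sub>v w) = 0\<^sub>v n" for w
      using B C by (auto intro!: eq_vecI simp: scalar_prod_def)
    then have "W \<subseteq> {0\<^sub>v n}" using BC by force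
    then show False using ne sub(2) by auto
  qed
  have M: "C * A * B \<in> carrier_mat r r" using A B C by auto
  obtain c where "c \<in> spectrum (C * A * B)" using spectrum_non_empty[OF M \<open>r > 0\<close>] by blast
  then obtain x where x: "x \<in> carrier_vec r" "x \<noteq> 0\<^sub>v r" and ev: "C * A * B *\<^sub>v x = c \<cdot>\<^sub>v x"
    using M by (auto simp: spectrum_def eigenvalue_def eigenvector_def)
  have CBx: "C *\<^sub>v (B *\<^sub>v x) = x"
    using assoc_mult_mat_vec[OF C B x(1)] CB x by simp
  have w: "B *\<^sub>v x \<in> W" using BW x by blast
  have "A *\<^sub>v (B *\<^sub>v x) = B *\<^sub>v (C *\<^sub>v (A *\<^sub>v (B *\<^sub>v x)))" using BC AW w by simp
  also have "C *\<^sub>v (A *\<^sub>v (B *\<^sub>v x)) = c \<cdot>\<^sub>v x"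
    using ev A B C x by (simp add: assoc_mult_mat_vec[of _ r n _ r] assoc_mult_mat_vec[of _ r n _ n])
  also have "B *\<^sub>v (c \<cdot>\<^sub>v x) = c \<cdot>\<^sub>v (B *\<^sub>v x)" using B x by (simp add: mult_mat_vec)
  finally have "A *\<^sub>v (B *\<^sub>v x) = c \<cdot>\<^sub>v (B *\<^sub>v x)" .
  moreover have "B *\<^sub>v x \<noteq> 0\<^sub>v n" using CBx x mat_mult_zero_vec[OF C] by auto
  ultimately show thesis using that w by blast
qed

text \<open>
  By induction on the family: the eigenspace in \<open>W\<close> of one of the matrices is preserved by all those that
  commute with it.
\<close>

lemma common_eigenvector:
  assumes "finite I" and "vec_subspace n W" "W \<noteq> {0\<^sub>v n}"
    and "\<And>i. i \<in> I \<Longrightarrow> A i \<in> carrier_mat n n" "\<And>i w. i \<in> I \<Longrightarrow> w \<in> W \<Longrightarrow> A i *\<^sub>v w \<in> W"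
    and "\<And>i j w. i \<in> I \<Longrightarrow> j \<in> I \<Longrightarrow> w \<in> W \<Longrightarrow> A i *\<^sub>v (A j *\<^sub>v w) = A j *\<^sub>v (A i *\<^sub>v w)"
  shows "\<exists>w\<in>W. w \<noteq> 0\<^sub>v n \<and> (\<forall>i\<in>I. \<exists>c. A i *\<^sub>v w = c \<cdot>\<^sub>v w)"
  using assms
proof (induction I arbitrary: W rule: finite_induct)
  case empty
  then show ?case using vec_subspaceD[OF empty(1)] by auto
next
  case (insert k I)
  have carr: "A k \<in> carrier_mat n n" using insert.prems(3)[of k] by simp
  note sub = vec_subspaceD[OF insert.prems(1)]
  obtain c w where w: "w \<in> W" "w \<noteq> 0\<^sub>v n" "A k *\<^sub>v w = c \<cdot>\<^sub>v w"
    using eigenvector_in_subspace[OF insert.prems(1,2) carr] insert.prems(4)[of k] by blast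
  define W' where "W' = {w \<in> W. A k *\<^sub>v w = c \<cdot>\<^sub>v w}"
  have "vec_subspace n W'"
  proof (rule vec_subspaceI)
    show "W' \<subseteq> carrier_vec n" "0\<^sub>v n \<in> W'"
      using sub(1,2) carr by (auto simp: W'_def intro!: eq_vecI)
    fix u v d assume uv: "u \<in> W'" "v \<in> W'"
    then have "u \<in> carrier_vec n" "v \<in> carrier_vec n" using sub(1) by (auto simp: W'_def)
    then show "u + v \<in> W'" "d \<cdot>\<^sub>v u \<in> W'"
      using uv sub(3,4) carr
      by (auto simp: W'_def mult_add_distrib_mat_vec[OF carr] mult_mat_vec[OF carr] smult_add_distrib_vec
          smult_smult_assoc mult.commute)
  qed
  moreover have "W' \<noteq> {0\<^sub>v n}" using w by (auto simp: W'_def)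
  moreover have "A i *\<^sub>v v \<in> W'" if "i \<in> I" "v \<in> W'" for i v
  proof -
    have v: "v \<in> W" "v \<in> carrier_vec n" and Av: "A k *\<^sub>v v = c \<cdot>\<^sub>v v" using that sub(1) by (auto simp: W'_def)
    have "A k *\<^sub>v (A i *\<^sub>v v) = A i *\<^sub>v (c \<cdot>\<^sub>v v)" using insert.prems(5)[of k i v] that v Av by simp
    also have "\<dots> = c \<cdot>\<^sub>v (A i *\<^sub>v v)" using insert.prems(3)[of i] that v by (simp add: mult_mat_vec)
    finally show ?thesis using insert.prems(4)[of i v] that v by (simp add: W'_def)
  qed
  ultimately have "\<exists>w\<in>W'. w \<noteq> 0\<^sub>v n \<and> (\<forall>i\<in>I. \<exists>c. A i *\<^sub>v w = c \<cdot>\<^sub>v w)"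
    by (intro insert.IH) (use insert.prems in \<open>auto simp: W'_def\<close>)
  then show ?case by (auto simp: W'_def)
qed

text \<open>
  The only way in which dimensions enter below; it replaces the vector space dimension by an elementary
  statement about vectors.
\<close>

lemma subspace_dim_le_1_iff:
  assumes W: "vec_subspace n W"
  shows "vectorspace.dim class_ring ((module_vec TYPE(complex) n)\<lparr>carrier := W\<rparr>) \<le> 1 \<longleftrightarrow>
    (\<exists>u\<in>W. \<forall>w\<in>W. \<exists>c. w = c \<cdot>\<^sub>v u)" (is "?dim \<le> 1 \<longleftrightarrow> ?R")
proof -
  interpret vec_space "TYPE(complex)" n .
  have sm: "submodule class_ring W V" using W by (simp add: VectorSpace.subspace_def)
  interpret W: vectorspace class_ring "vs W" using subspace_is_vs[OF W] .
  note sub = vec_subspaceD[OF W]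
  have span_eq: "W.span S = span S" if "S \<subseteq> W" for S
    using span_li_not_depend(1)[OF that sm] .
  have li_eq: "W.lin_dep S \<longleftrightarrow> lin_dep S" if "S \<subseteq> W" for S
    using span_li_not_depend(2)[OF that sm] by simp
  show ?thesis
  proof
    assume ?R
    then obtain u where u: "u \<in> W" "\<And>w. w \<in> W \<Longrightarrow> \<exists>c. w = c \<cdot>\<^sub>v u" by blast
    have uc: "u \<in> carrier_vec n" using u sub(1) by auto
    have "w \<in> span {u}" if w: "w \<in> W" for w
      using u(2)[OF w] in_own_span[of "{u}"] span_is_subspace[of "{u}"] vec_subspaceD(4)[of "span {u}" n] uc
      by auto
    then have "W \<subseteq> W.span {u}" using u span_eq by auto
    moreover have "W.span {u} \<subseteq> W" using W.span_closed[of "{u}"] u by auto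
    ultimately have "W.gen_set {u}" by simp
    then show "?dim \<le> 1" using W.dim_le1I[of u] u by simp
  next
    assume d: "?dim \<le> 1"
    obtain r B C where B: "B \<in> carrier_mat n r" and C: "C \<in> carrier_mat r n"
      and BW: "\<And>x. x \<in> carrier_vec r \<Longrightarrow> B *\<^sub>v x \<in> W" and BC: "\<And>w. w \<in> W \<Longrightarrow> B *\<^sub>v (C *\<^sub>v w) = w"
      by (rule subspace_parametrization[OF W]) blast
    have "W = col_space B"
    proof
      show "W \<subseteq> col_space B"
      proof
        fix w assume w: "w \<in> W"
        then have "w \<in> carrier_vec n" "C *\<^sub>v w \<in> carrier_vec r" using sub(1) C by auto
        then show "w \<in> col_space B" using BC[OF w] B unfolding col_space_eq[OF B] by blast
      qed
      show "col_space B \<subseteq> W" using BW B unfolding col_space_eq[OF B] by auto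
    qed
    then have "W.fin_dim" using fin_dim_span_cols[OF B] by (simp add: col_space_def)
    then obtain S where S: "finite S" "W.basis S" using W.finite_basis_exists by blast
    then have card: "card S \<le> 1" using d W.dim_basis by simp
    have SW: "S \<subseteq> W" and gen: "W = span S"
      using S(2) span_eq[of S] by (auto simp: W.basis_def)
    show "\<exists>u\<in>W. \<forall>w\<in>W. \<exists>c. w = c \<cdot>\<^sub>v u"
    proof (cases "S = {}")
      case True
      then have "W = {0\<^sub>v n}" using gen span_empty by (simp add: module_vec_simps)
      then show ?thesis by auto
    next
      case False
      then obtain u where u: "S = {u}" using card S(1) by (metis One_nat_def card_1_singletonE card_gt_0_iff le_antisym less_eq_Suc_le)
      then have uc: "u \<in> carrier_vec n" using SW sub(1) by auto
      have "\<exists>c. w = c \<cdot>\<^sub>v u" if w: "w \<in> W" for w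
      proof -
        obtain a where "w = lincomb a {u}" using w gen u uc finite_span[of "{u}"] by auto
        also have "\<dots> = a u \<cdot>\<^sub>v u" using uc by (auto simp: lincomb_def)
        finally show ?thesis by blast
      qed
      then show ?thesis using SW u by auto
    qed
  qed
qed

section \<open>Means and traces of matrices\<close>

text \<open>
  The general rules of the same kind leave the inner dimensions of a product to be guessed by the
  simplifier; fixing all of them to \<open>n\<close> makes the rules usable for rewriting.
\<close>

lemmas sq_assoc = assoc_mult_mat[of _ n n _ n _ n] for n
lemmas sq_assoc_vec = assoc_mult_mat_vec[of _ n n _ n] for n
lemmas sq_vec_carrier = mult_mat_vec_carrier[of _ n n] for n
lemmas sq_carrier = mult_carrier_mat[of _ n n _ n] for n

lemma mat_mult_index:
  fixes A B :: "complex mat"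
  assumes "A \<in> carrier_mat n m" "B \<in> carrier_mat m p" "i < n" "j < p"
  shows "(A * B) $$ (i,j) = (\<Sum>l\<in>{0..<m}. A $$ (i,l) * B $$ (l,j))"
  using assms by (auto simp: scalar_prod_def)

lemma mat_vec_index:
  fixes A :: "complex mat"
  assumes "A \<in> carrier_mat n m" "v \<in> carrier_vec m" "i < n"
  shows "(A *\<^sub>v v) $ i = (\<Sum>l\<in>{0..<m}. A $$ (i,l) * v $ l)"
  using assms by (auto simp: scalar_prod_def)

lemma eq_mat_mult_vecI:
  fixes A B :: "complex mat"
  assumes "A \<in> carrier_mat n m" "B \<in> carrier_mat n m"
    and "\<And>v. v \<in> carrier_vec m \<Longrightarrow> A *\<^sub>v v = B *\<^sub>v v"
  shows "A = B"
proof (rule mat_col_eqI)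
  fix j assume "j < dim_col B"
  then have j: "j < m" using assms by auto
  have "M *\<^sub>v unit_vec m j = col M j" if "M \<in> carrier_mat n m" for M :: "complex mat"
  proof (rule eq_vecI)
    fix i assume "i < dim_vec (col M j)"
    then show "(M *\<^sub>v unit_vec m j) $ i = col M j $ i" using that j by simp
  qed (use that in simp)
  then show "col A j = col B j" using assms(1,2) assms(3)[of "unit_vec m j"] by simp
qed (use assms in auto)

definition mean_mat :: "nat \<Rightarrow> nat \<Rightarrow> 'i set \<Rightarrow> ('i \<Rightarrow> complex mat) \<Rightarrow> complex mat" where
  "mean_mat n m I F = mat n m (\<lambda>(i,j). (\<Sum>k\<in>I. F k $$ (i,j)) / of_nat (card I))"

lemma mean_mat_carrier [simp]: "mean_mat n m I F \<in> carrier_mat n m"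
  by (simp add: mean_mat_def)

lemma mean_mat_index:
  "i < n \<Longrightarrow> j < m \<Longrightarrow> mean_mat n m I F $$ (i,j) = (\<Sum>k\<in>I. F k $$ (i,j)) / of_nat (card I)"
  by (simp add: mean_mat_def)

lemma mean_mat_cong: "(\<And>k. k \<in> I \<Longrightarrow> F k = F' k) \<Longrightarrow> mean_mat n m I F = mean_mat n m I F'"
  by (auto simp: mean_mat_def intro!: eq_matI)

lemma mean_mat_reindex:
  assumes "bij_betw f I J"
  shows "mean_mat n m I (\<lambda>k. F (f k)) = mean_mat n m J F"
  using sum.reindex_bij_betw[OF assms, of "\<lambda>k. F k $$ ij" for ij] bij_betw_same_card[OF assms]
  by (auto simp: mean_mat_def intro!: eq_matI)

lemma mean_mat_const:
  assumes "finite I" "I \<noteq> {}" "A \<in> carrier_mat n m" "\<And>k. k \<in> I \<Longrightarrow> F k = A"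
  shows "mean_mat n m I F = A"
  using assms by (auto simp: mean_mat_def intro!: eq_matI)

lemma mult_mean_mat:
  assumes A: "A \<in> carrier_mat p n" and F: "\<And>k. k \<in> I \<Longrightarrow> F k \<in> carrier_mat n m"
  shows "A * mean_mat n m I F = mean_mat p m I (\<lambda>k. A * F k)"
proof (rule eq_matI)
  fix i j assume "i < dim_row (mean_mat p m I (\<lambda>k. A * F k))" "j < dim_col (mean_mat p m I (\<lambda>k. A * F k))"
  then have ij: "i < p" "j < m" by (auto simp: mean_mat_def)
  have "(A * mean_mat n m I F) $$ (i,j)
      = (\<Sum>l\<in>{0..<n}. A $$ (i,l) * (\<Sum>k\<in>I. F k $$ (l,j))) / of_nat (card I)"
    using ij mat_mult_index[OF A mean_mat_carrier ij, of I F]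
    by (simp add: mean_mat_index sum_divide_distrib[symmetric])
  also have "(\<Sum>l\<in>{0..<n}. A $$ (i,l) * (\<Sum>k\<in>I. F k $$ (l,j)))
      = (\<Sum>k\<in>I. \<Sum>l\<in>{0..<n}. A $$ (i,l) * F k $$ (l,j))"
    by (subst sum.swap) (simp add: sum_distrib_left)
  also have "\<dots> = (\<Sum>k\<in>I. (A * F k) $$ (i,j))"
    using ij A F by (intro sum.cong refl mat_mult_index[symmetric]) blast+
  finally show "(A * mean_mat n m I F) $$ (i,j) = mean_mat p m I (\<lambda>k. A * F k) $$ (i,j)"
    using ij by (simp add: mean_mat_index)
qed (use A in \<open>auto simp: mean_mat_def\<close>)

lemma transpose_mean_mat:
  assumes "\<And>k. k \<in> I \<Longrightarrow> F k \<in> carrier_mat n m"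
  shows "(mean_mat n m I F)\<^sup>T = mean_mat m n I (\<lambda>k. (F k)\<^sup>T)"
proof (rule eq_matI)
  fix i j assume "i < dim_row (mean_mat m n I (\<lambda>k. (F k)\<^sup>T))" "j < dim_col (mean_mat m n I (\<lambda>k. (F k)\<^sup>T))"
  then have ij: "i < m" "j < n" by (auto simp: mean_mat_def)
  have "(\<Sum>k\<in>I. F k $$ (j,i)) = (\<Sum>k\<in>I. (F k)\<^sup>T $$ (i,j))"
  proof (intro sum.cong refl)
    fix k assume "k \<in> I"
    then show "F k $$ (j,i) = (F k)\<^sup>T $$ (i,j)" using assms[of k] ij by simp
  qed
  then show "(mean_mat n m I F)\<^sup>T $$ (i,j) = mean_mat m n I (\<lambda>k. (F k)\<^sup>T) $$ (i,j)"
    using ij by (simp add: mean_mat_def)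
qed (auto simp: mean_mat_def)

lemma mean_mat_mult:
  assumes A: "A \<in> carrier_mat m p" and F: "\<And>k. k \<in> I \<Longrightarrow> F k \<in> carrier_mat n m"
  shows "mean_mat n m I F * A = mean_mat n p I (\<lambda>k. F k * A)"
proof -
  have "(mean_mat n m I F * A)\<^sup>T = A\<^sup>T * mean_mat m n I (\<lambda>k. (F k)\<^sup>T)"
    using A F by (simp add: transpose_mult[of _ n m _ p] transpose_mean_mat)
  also have "\<dots> = mean_mat p n I (\<lambda>k. A\<^sup>T * (F k)\<^sup>T)"
    using A F by (intro mult_mean_mat) auto
  also have "\<dots> = mean_mat p n I (\<lambda>k. (F k * A)\<^sup>T)"
    using A F by (intro mean_mat_cong) (simp add: transpose_mult[of _ n m _ p])
  also have "\<dots> = (mean_mat n p I (\<lambda>k. F k * A))\<^sup>T"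
    using A F mult_carrier_mat by (intro transpose_mean_mat[symmetric]) blast
  finally show ?thesis by simp
qed

lemma mean_mat_mult_vec:
  assumes "finite I" "I \<noteq> {}" "v \<in> carrier_vec m" "w \<in> carrier_vec n"
    and "\<And>k. k \<in> I \<Longrightarrow> F k \<in> carrier_mat n m" "\<And>k. k \<in> I \<Longrightarrow> F k *\<^sub>v v = w"
  shows "mean_mat n m I F *\<^sub>v v = w"
proof (rule eq_vecI)
  fix i assume "i < dim_vec w"
  then have i: "i < n" using assms by simp
  have "(mean_mat n m I F *\<^sub>v v) $ i
      = (\<Sum>l\<in>{0..<m}. (\<Sum>k\<in>I. F k $$ (i,l)) * v $ l) / of_nat (card I)"
    using i mat_vec_index[OF mean_mat_carrier assms(3) i, of I F]
    by (simp add: mean_mat_index sum_divide_distrib[symmetric])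
  also have "(\<Sum>l\<in>{0..<m}. (\<Sum>k\<in>I. F k $$ (i,l)) * v $ l) = (\<Sum>k\<in>I. \<Sum>l\<in>{0..<m}. F k $$ (i,l) * v $ l)"
    by (subst sum.swap) (simp add: sum_distrib_right)
  also have "\<dots> = (\<Sum>k\<in>I. (F k *\<^sub>v v) $ i)"
    using i assms(3,5) by (intro sum.cong refl mat_vec_index[symmetric]) blast+
  also have "\<dots> = of_nat (card I) * w $ i" using assms(6) by simp
  finally show "(mean_mat n m I F *\<^sub>v v) $ i = w $ i" using assms(1,2) by simp
qed (use assms(4) in \<open>simp add: mean_mat_def\<close>)

definition mat_trace :: "complex mat \<Rightarrow> complex" where
  "mat_trace A = (\<Sum>i\<in>{0..<dim_row A}. A $$ (i,i))"

lemma mat_trace_comm: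
  assumes "A \<in> carrier_mat n m" "B \<in> carrier_mat m n"
  shows "mat_trace (A * B) = mat_trace (B * A)"
proof -
  have "mat_trace (A * B) = (\<Sum>i\<in>{0..<n}. \<Sum>j\<in>{0..<m}. A $$ (i,j) * B $$ (j,i))"
    using assms by (auto simp: mat_trace_def scalar_prod_def intro!: sum.cong)
  also have "\<dots> = (\<Sum>j\<in>{0..<m}. \<Sum>i\<in>{0..<n}. B $$ (j,i) * A $$ (i,j))"
    by (subst sum.swap) (simp add: mult.commute)
  also have "\<dots> = mat_trace (B * A)"
    using assms by (auto simp: mat_trace_def scalar_prod_def intro!: sum.cong)
  finally show ?thesis .
qed

lemma mat_trace_mean_mat:
  assumes "finite I" "I \<noteq> {}" "\<And>k. k \<in> I \<Longrightarrow> F k \<in> carrier_mat n n" "\<And>k. k \<in> I \<Longrightarrow> mat_trace (F k) = t"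
  shows "mat_trace (mean_mat n n I F) = t"
proof -
  have "mat_trace (mean_mat n n I F) = (\<Sum>k\<in>I. \<Sum>i\<in>{0..<n}. F k $$ (i,i)) / of_nat (card I)"
    by (subst sum.swap) (simp add: mat_trace_def mean_mat_def sum_divide_distrib)
  also have "(\<Sum>k\<in>I. \<Sum>i\<in>{0..<n}. F k $$ (i,i)) = (\<Sum>k\<in>I. t)"
  proof (intro sum.cong refl)
    fix k assume "k \<in> I"
    then show "(\<Sum>i\<in>{0..<n}. F k $$ (i,i)) = t" using assms(3,4)[of k] by (auto simp: mat_trace_def)
  qed
  finally show ?thesis using assms(1,2) by simp
qed

lemma smult_smult_mat: "a \<cdot>\<^sub>m (b \<cdot>\<^sub>m A) = (a * b) \<cdot>\<^sub>m A" for a b :: complex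
  by (auto intro!: eq_matI)

lemma mean_mat_smult:
  assumes "A \<in> carrier_mat n m" "\<And>k. k \<in> I \<Longrightarrow> F k = c k \<cdot>\<^sub>m A"
  shows "mean_mat n m I F = ((\<Sum>k\<in>I. c k) / of_nat (card I)) \<cdot>\<^sub>m A"
proof (rule eq_matI)
  fix i j assume "i < dim_row (((\<Sum>k\<in>I. c k) / of_nat (card I)) \<cdot>\<^sub>m A)" "j < dim_col (((\<Sum>k\<in>I. c k) / of_nat (card I)) \<cdot>\<^sub>m A)"
  then have ij: "i < n" "j < m" using assms by auto
  have "(\<Sum>k\<in>I. F k $$ (i,j)) = (\<Sum>k\<in>I. c k * A $$ (i,j))"
    using assms ij by (intro sum.cong) auto
  then show "mean_mat n m I F $$ (i,j) = (((\<Sum>k\<in>I. c k) / of_nat (card I)) \<cdot>\<^sub>m A) $$ (i,j)"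
    using ij assms(1) by (simp add: mean_mat_index sum_distrib_right)
qed (use assms in \<open>auto simp: mean_mat_def\<close>)

section \<open>Representations by matrices\<close>

lemma bij_of_trivial_kernel:
  fixes T :: "complex mat"
  assumes T: "T \<in> carrier_mat n n" and ker: "\<And>v. v \<in> carrier_vec n \<Longrightarrow> T *\<^sub>v v = 0\<^sub>v n \<Longrightarrow> v = 0\<^sub>v n"
  shows "bij_betw (\<lambda>v. T *\<^sub>v v) (carrier_vec n) (carrier_vec n)"
proof -
  have "det T \<noteq> 0" using det_0_iff_vec_prod_zero_field[OF T] ker by blast
  then obtain S where S: "S \<in> carrier_mat n n" "S * T = 1\<^sub>m n" "T * S = 1\<^sub>m n"
    using det_non_zero_imp_unit[OF T] by (auto simp: Units_def ring_mat_def)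
  show ?thesis
  proof (rule bij_betw_byWitness[of _ "\<lambda>v. S *\<^sub>v v"])
    show "\<forall>v\<in>carrier_vec n. S *\<^sub>v (T *\<^sub>v v) = v" "\<forall>v\<in>carrier_vec n. T *\<^sub>v (S *\<^sub>v v) = v"
      using S T by (metis assoc_mult_mat_vec one_mult_mat_vec)+
  qed (use S T in auto)
qed

text \<open>
  An eigenspace of \<open>S\<close> is invariant, hence everything.
\<close>

lemma schur:
  assumes irr: "irreducible_rep G n \<rho>" and carr: "\<And>g. g \<in> carrier G \<Longrightarrow> \<rho> g \<in> carrier_mat n n"
    and S: "S \<in> carrier_mat n n" and comm: "\<And>g. g \<in> carrier G \<Longrightarrow> S * \<rho> g = \<rho> g * S"
  obtains s where "S = s \<cdot>\<^sub>m 1\<^sub>m n"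
proof -
  have n: "n \<noteq> 0" using irr by (simp add: irreducible_rep_def)
  have V: "vec_subspace n (carrier_vec n)" by (rule vec_subspaceI) auto
  have "unit_vec n 0 \<noteq> (0\<^sub>v n :: complex vec)"
    using n arg_cong[of "unit_vec n 0" "0\<^sub>v n :: complex vec" "\<lambda>v. v $ 0"] by auto
  then have "carrier_vec n \<noteq> {0\<^sub>v n :: complex vec}" by (metis singletonD unit_vec_carrier)
  then obtain s w where w: "w \<in> carrier_vec n" "w \<noteq> 0\<^sub>v n" "S *\<^sub>v w = s \<cdot>\<^sub>v w"
    using eigenvector_in_subspace[OF V _ S] S by (metis mult_mat_vec_carrier)
  define W where "W = {v \<in> carrier_vec n. S *\<^sub>v v = s \<cdot>\<^sub>v v}"
  have "vec_subspace n W"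
    using S by (intro vec_subspaceI)
      (auto simp: W_def mult_add_distrib_mat_vec mult_mat_vec smult_add_distrib_vec smult_smult_assoc mult.commute intro!: eq_vecI)
  moreover have "\<rho> g *\<^sub>v v \<in> W" if g: "g \<in> carrier G" and v: "v \<in> W" for g v
  proof -
    have vc: "v \<in> carrier_vec n" and Sv: "S *\<^sub>v v = s \<cdot>\<^sub>v v" using v by (auto simp: W_def)
    have "S *\<^sub>v (\<rho> g *\<^sub>v v) = \<rho> g *\<^sub>v (S *\<^sub>v v)"
      using comm[OF g] carr[OF g] S vc by (metis assoc_mult_mat_vec)
    also have "\<dots> = s \<cdot>\<^sub>v (\<rho> g *\<^sub>v v)" unfolding Sv using carr[OF g] vc by (simp add: mult_mat_vec)
    finally show ?thesis using carr[OF g] vc by (simp add: W_def)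
  qed
  moreover have "W \<noteq> {0\<^sub>v n}" using w by (auto simp: W_def)
  ultimately have "W = carrier_vec n"
    using irr unfolding irreducible_rep_def invariant_subspace_def by blast
  then have ev: "S *\<^sub>v v = s \<cdot>\<^sub>v v" if "v \<in> carrier_vec n" for v using that by (auto simp: W_def)
  have "S = s \<cdot>\<^sub>m 1\<^sub>m n"
  proof (rule eq_mat_mult_vecI[of _ n n])
    fix v :: "complex vec" assume v: "v \<in> carrier_vec n"
    have "s \<cdot>\<^sub>m 1\<^sub>m n *\<^sub>v v = s \<cdot>\<^sub>v v" using v by (auto intro!: eq_vecI)
    then show "S *\<^sub>v v = s \<cdot>\<^sub>m 1\<^sub>m n *\<^sub>v v" using ev[OF v] by simp
  qed (use S in auto)
  then show thesis by (rule that)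
qed

lemma representation_mult:
  assumes "representation G n \<rho>" "g \<in> carrier G" "h \<in> carrier G"
  shows "\<rho> (g \<otimes>\<^bsub>G\<^esub> h) = \<rho> g * \<rho> h"
  using assms by (auto simp: representation_def hom_def GL_def units_of_def ring_mat_def)

lemma representation_one:
  assumes "group G" "representation G n \<rho>"
  shows "\<rho> \<one>\<^bsub>G\<^esub> = 1\<^sub>m n"
proof -
  interpret G: group G by fact
  have "\<rho> \<one>\<^bsub>G\<^esub> \<in> Units (ring_mat TYPE(complex) n ())"
    using assms(2) by (auto simp: representation_def hom_def GL_def units_of_def)
  then obtain S where S: "S \<in> carrier_mat n n" "S * \<rho> \<one>\<^bsub>G\<^esub> = 1\<^sub>m n"
    by (auto simp: Units_def ring_mat_def)
  have c: "\<rho> \<one>\<^bsub>G\<^esub> \<in> carrier_mat n n" using representation_carrier[OF assms(2)] by simp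
  have "\<rho> \<one>\<^bsub>G\<^esub> = S * \<rho> \<one>\<^bsub>G\<^esub> * \<rho> \<one>\<^bsub>G\<^esub>"
    using S c by (simp del: assoc_mult_mat)
  also have "\<dots> = S * \<rho> (\<one>\<^bsub>G\<^esub> \<otimes>\<^bsub>G\<^esub> \<one>\<^bsub>G\<^esub>)"
    unfolding representation_mult[OF assms(2) G.one_closed G.one_closed] by (rule assoc_mult_mat[OF S(1) c c])
  also have "\<dots> = 1\<^sub>m n" using S by simp
  finally show ?thesis .
qed

lemma representationI:
  assumes "group G" "\<And>g. g \<in> carrier G \<Longrightarrow> \<rho> g \<in> carrier_mat n n"
    and "\<And>g h. g \<in> carrier G \<Longrightarrow> h \<in> carrier G \<Longrightarrow> \<rho> (g \<otimes>\<^bsub>G\<^esub> h) = \<rho> g * \<rho> h"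
    and "\<rho> \<one>\<^bsub>G\<^esub> = 1\<^sub>m n"
  shows "representation G n \<rho>"
proof -
  interpret G: group G by fact
  have "\<rho> g * \<rho> (inv\<^bsub>G\<^esub> g) = 1\<^sub>m n" "\<rho> (inv\<^bsub>G\<^esub> g) * \<rho> g = 1\<^sub>m n" if "g \<in> carrier G" for g
    using that assms(3)[of g "inv\<^bsub>G\<^esub> g"] assms(3)[of "inv\<^bsub>G\<^esub> g" g] assms(4) by simp_all
  then show ?thesis
    using assms(2,3) unfolding representation_def hom_def GL_def units_of_def Units_def ring_mat_def
    by (auto intro!: bexI[of _ "\<rho> (inv\<^bsub>G\<^esub> g)" for g])
qed

section \<open>Groups with an involution and a stable subgroup\<close>

locale symmetric_pair = group G for G :: "('a, 'b) monoid_scheme" (structure) +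
  fixes \<theta> :: "'a \<Rightarrow> 'a" and H :: "'a set"
  assumes finite_carrier: "finite (carrier G)"
    and theta_iso: "\<theta> \<in> iso G G"
    and theta_theta: "\<And>g. g \<in> carrier G \<Longrightarrow> \<theta> (\<theta> g) = g"
    and subgroup_H: "subgroup H G"
    and theta_H: "\<theta> ` H = H"
begin

lemma theta_closed [simp]: "g \<in> carrier G \<Longrightarrow> \<theta> g \<in> carrier G"
  using theta_iso by (auto simp: iso_def hom_def)

lemma theta_mult: "g \<in> carrier G \<Longrightarrow> h \<in> carrier G \<Longrightarrow> \<theta> (g \<otimes> h) = \<theta> g \<otimes> \<theta> h"
  using theta_iso by (auto simp: iso_def hom_def)

lemma theta_one: "\<theta> \<one> = \<one>"
  by (metis l_cancel_one one_closed r_one theta_closed theta_mult)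

lemma H_closed [simp]: "h \<in> H \<Longrightarrow> h \<in> carrier G"
  using subgroup.mem_carrier[OF subgroup_H] .

lemma H_finite [simp]: "finite H"
  using finite_carrier subgroup.subset[OF subgroup_H] finite_subset by blast

lemma H_nonempty [simp]: "H \<noteq> {}"
  using subgroup.one_closed[OF subgroup_H] by blast

lemma theta_H_closed [simp]: "h \<in> H \<Longrightarrow> \<theta> h \<in> H"
  using theta_H by blast

lemma H_inv [simp]: "h \<in> H \<Longrightarrow> inv h \<in> H"
  using subgroup.m_inv_closed[OF subgroup_H] .

lemma bij_theta_H: "bij_betw \<theta> H H"
  by (rule bij_betw_byWitness[of _ \<theta>]) (auto simp: theta_theta)

lemma bij_inv_H: "bij_betw (\<lambda>h. inv h) H H"
  by (rule bij_betw_byWitness[of _ "\<lambda>h. inv h"]) auto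

lemma bij_mult_left:
  assumes "subgroup K G" "k \<in> K"
  shows "bij_betw (\<lambda>h. k \<otimes> h) K K"
proof (rule bij_betw_byWitness[of _ "\<lambda>h. inv k \<otimes> h"])
  note K = subgroup.mem_carrier[OF assms(1)] subgroup.m_closed[OF assms(1)] subgroup.m_inv_closed[OF assms(1)]
  show "\<forall>a\<in>K. inv k \<otimes> (k \<otimes> a) = a" "\<forall>a\<in>K. k \<otimes> (inv k \<otimes> a) = a"
    using K assms(2) by (auto simp: m_assoc[symmetric])
  show "(\<lambda>h. k \<otimes> h) ` K \<subseteq> K" "(\<lambda>h. inv k \<otimes> h) ` K \<subseteq> K" using K assms(2) by auto
qed

lemma bij_mult_right:
  assumes "subgroup K G" "k \<in> K"
  shows "bij_betw (\<lambda>h. h \<otimes> k) K K"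
proof (rule bij_betw_byWitness[of _ "\<lambda>h. h \<otimes> inv k"])
  note K = subgroup.mem_carrier[OF assms(1)] subgroup.m_closed[OF assms(1)] subgroup.m_inv_closed[OF assms(1)]
  show "\<forall>a\<in>K. a \<otimes> k \<otimes> inv k = a" "\<forall>a\<in>K. a \<otimes> inv k \<otimes> k = a"
    using K assms(2) by (auto simp: m_assoc)
  show "(\<lambda>h. h \<otimes> k) ` K \<subseteq> K" "(\<lambda>h. h \<otimes> inv k) ` K \<subseteq> K" using K assms(2) by auto
qed

text \<open>
  Shifting the summation variable by \<open>x\<close> turns \<open>\<rho> x\<close> on the right into \<open>\<sigma> x\<close> on the left. It serves three
  purposes: Maschke's theorem, the matrix to which Schur's lemma is applied, and the intertwiner from
  \<open>\<rho> \<circ> \<theta>\<close> to the dual of \<open>\<rho>\<close>.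
\<close>

lemma mean_intertwines:
  assumes rep: "representation G n \<rho>" and rep': "representation G n \<sigma>"
    and A: "A \<in> carrier_mat n n" and x: "x \<in> carrier G"
  shows "mean_mat n n (carrier G) (\<lambda>g. \<sigma> g * A * \<rho> (inv g)) * \<rho> x
    = \<sigma> x * mean_mat n n (carrier G) (\<lambda>g. \<sigma> g * A * \<rho> (inv g))"
proof -
  note [simp] = representation_carrier[OF rep] representation_carrier[OF rep']
  define F where "F g = \<sigma> g * A * \<rho> (inv g)" for g
  have F: "F g \<in> carrier_mat n n" if "g \<in> carrier G" for g
    using that A by (simp add: F_def sq_carrier[where n=n])
  have "mean_mat n n (carrier G) F * \<rho> x = mean_mat n n (carrier G) (\<lambda>g. F (x \<otimes> g) * \<rho> x)"
    unfolding mean_mat_reindex[OF bij_mult_left[OF subgroup_self x], of n n F, symmetric]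
    using x F by (intro mean_mat_mult) auto
  also have "\<dots> = mean_mat n n (carrier G) (\<lambda>g. \<sigma> x * F g)"
  proof (rule mean_mat_cong)
    fix g assume g: "g \<in> carrier G"
    have "F (x \<otimes> g) * \<rho> x = \<sigma> x * \<sigma> g * A * \<rho> (inv g) * (\<rho> (inv x) * \<rho> x)"
      using x g A by (simp add: F_def representation_mult[OF rep] representation_mult[OF rep'] inv_mult_group
          sq_assoc[where n=n] sq_carrier[where n=n])
    also have "\<rho> (inv x) * \<rho> x = 1\<^sub>m n"
      using x representation_mult[OF rep, of "inv x" x] representation_one[OF is_group rep] by simp
    finally show "F (x \<otimes> g) * \<rho> x = \<sigma> x * F g"
      using x g A right_mult_one_mat[of "\<rho> (inv g)" n n] by (simp add: F_def sq_assoc[where n=n] sq_carrier[where n=n])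
  qed
  also have "\<dots> = \<sigma> x * mean_mat n n (carrier G) F"
    using x F by (intro mult_mean_mat[symmetric]) auto
  finally show ?thesis unfolding F_def .
qed

lemma representation_dual:
  assumes "representation G n \<rho>"
  shows "representation G n (dual_rep G \<rho>)"
proof (rule representationI[OF is_group])
  note [simp] = representation_carrier[OF assms]
  show "dual_rep G \<rho> g \<in> carrier_mat n n" if "g \<in> carrier G" for g
    using that by (simp add: dual_rep_def)
  show "dual_rep G \<rho> (g \<otimes> h) = dual_rep G \<rho> g * dual_rep G \<rho> h" if "g \<in> carrier G" "h \<in> carrier G" for g h
    using that by (simp add: dual_rep_def inv_mult_group representation_mult[OF assms] transpose_mult[of _ n n _ n])
  show "dual_rep G \<rho> \<one> = 1\<^sub>m n"
    using representation_one[OF is_group assms] by (simp add: dual_rep_def)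
qed

lemma representation_comp_theta:
  assumes "representation G n \<rho>"
  shows "representation G n (\<rho> \<circ> \<theta>)"
  using assms representation_carrier[OF assms] representation_mult[OF assms] representation_one[OF is_group assms]
  by (intro representationI[OF is_group]) (simp_all add: theta_mult theta_one)

section \<open>Twist symmetry\<close>

definition H_projector :: "nat \<Rightarrow> ('a \<Rightarrow> complex mat) \<Rightarrow> complex mat" where
  "H_projector n \<rho> = mean_mat n n H \<rho>"

text \<open>
  The two sides are the actions of \<open>\<theta> g\<close> and of \<open>g\<^sup>-\<^sup>1\<close>, compressed to the \<open>H\<close>-invariant vectors.
\<close>

definition twist_symmetric :: "nat \<Rightarrow> ('a \<Rightarrow> complex mat) \<Rightarrow> bool" where
  "twist_symmetric n \<rho> \<longleftrightarrow> (\<forall>g\<in>carrier G.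
     H_projector n \<rho> * \<rho> (\<theta> g) * H_projector n \<rho> = H_projector n \<rho> * \<rho> (inv g) * H_projector n \<rho>)"

lemma twist_symmetricD:
  "twist_symmetric n \<rho> \<Longrightarrow> g \<in> carrier G \<Longrightarrow>
    H_projector n \<rho> * \<rho> (\<theta> g) * H_projector n \<rho> = H_projector n \<rho> * \<rho> (inv g) * H_projector n \<rho>"
  by (simp add: twist_symmetric_def)

lemma H_projector_carrier [simp]: "H_projector n \<rho> \<in> carrier_mat n n"
  by (simp add: H_projector_def)

context
  fixes n \<rho>
  assumes rep: "representation G n \<rho>"
begin

private abbreviation "e \<equiv> H_projector n \<rho>"

lemma rep_carrier [simp]: "g \<in> carrier G \<Longrightarrow> \<rho> g \<in> carrier_mat n n"
  using representation_carrier[OF rep] .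

lemma rep_mult: "g \<in> carrier G \<Longrightarrow> h \<in> carrier G \<Longrightarrow> \<rho> (g \<otimes> h) = \<rho> g * \<rho> h"
  using representation_mult[OF rep] .

lemma rep_one: "\<rho> \<one> = 1\<^sub>m n"
  using representation_one[OF is_group rep] .

lemma rep_inv:
  assumes "g \<in> carrier G"
  shows "\<rho> g * \<rho> (inv g) = 1\<^sub>m n" "\<rho> (inv g) * \<rho> g = 1\<^sub>m n"
  using assms rep_mult[of g "inv g"] rep_mult[of "inv g" g] rep_one by simp_all

lemma H_projector_absorb:
  assumes "h \<in> H"
  shows "\<rho> h * e = e" "e * \<rho> h = e"
proof -
  have "\<rho> h * e = mean_mat n n H (\<lambda>k. \<rho> (h \<otimes> k))"
    unfolding H_projector_def using assms
    by (subst mult_mean_mat[of _ n]) (auto simp: rep_mult intro: mean_mat_cong)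
  then show "\<rho> h * e = e"
    unfolding H_projector_def using mean_mat_reindex[OF bij_mult_left[OF subgroup_H assms]] by simp
  have "e * \<rho> h = mean_mat n n H (\<lambda>k. \<rho> (k \<otimes> h))"
    unfolding H_projector_def using assms
    by (subst mean_mat_mult[of _ n n]) (auto simp: rep_mult intro: mean_mat_cong)
  then show "e * \<rho> h = e"
    unfolding H_projector_def using mean_mat_reindex[OF bij_mult_right[OF subgroup_H assms]] by simp
qed

lemma H_projector_idem: "e * e = e"
proof -
  have "e * e = mean_mat n n H (\<lambda>h. \<rho> h * e)"
    unfolding H_projector_def[of n \<rho>] by (rule mean_mat_mult) auto
  also have "\<dots> = e" using H_projector_absorb by (intro mean_mat_const) auto
  finally show ?thesis .
qed

lemma H_projector_invariant:
  assumes "v \<in> carrier_vec n"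
  shows "e *\<^sub>v v \<in> invariants H n \<rho>"
proof -
  have "\<rho> h *\<^sub>v (e *\<^sub>v v) = e *\<^sub>v v" if "h \<in> H" for h
    using assoc_mult_mat_vec[of "\<rho> h" n n e n v] H_projector_absorb(1)[OF that] that assms by simp
  then show ?thesis using assms mult_mat_vec_carrier[of e n n v] by (auto simp: invariants_def)
qed

lemma H_projector_fixes: "v \<in> invariants H n \<rho> \<Longrightarrow> e *\<^sub>v v = v"
  unfolding H_projector_def by (rule mean_mat_mult_vec) (auto simp: invariants_def)

lemma H_projector_double_coset:
  assumes "g \<in> carrier G" "h \<in> H" "k \<in> H"
  shows "e * \<rho> (h \<otimes> g \<otimes> k) * e = e * \<rho> g * e"
proof -
  have "e * \<rho> (h \<otimes> g \<otimes> k) * e = (e * \<rho> h) * \<rho> g * (\<rho> k * e)"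
    using assms by (simp add: rep_mult sq_assoc[where n=n] sq_carrier[where n=n])
  then show ?thesis using H_projector_absorb assms by simp
qed

lemma double_cosets_imp_twist_symmetric:
  assumes "\<forall>g\<in>carrier G. \<exists>h\<^sub>1\<in>H. \<exists>h\<^sub>2\<in>H. h\<^sub>1 \<otimes> inv g \<otimes> h\<^sub>2 = \<theta> g"
  shows "twist_symmetric n \<rho>"
  unfolding twist_symmetric_def
proof
  fix g assume g: "g \<in> carrier G"
  then obtain h k where "h \<in> H" "k \<in> H" "h \<otimes> inv g \<otimes> k = \<theta> g" using assms by blast
  then show "e * \<rho> (\<theta> g) * e = e * \<rho> (inv g) * e"
    using H_projector_double_coset[of "inv g" h k] g by simp
qed

section \<open>Reduction to irreducible representations\<close>

text \<open>
  The range of \<open>P\<close> is a subrepresentation of smaller degree. Written in coordinates it becomes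
  \<open>\<sigma> x = C \<rho>(x) B\<close> with \<open>P = B C\<close>. The compression \<open>X \<mapsto> C X B\<close> is multiplicative on the matrices that
  commute with \<open>P\<close>, and \<open>B (C X B) C = P X\<close> for them; so twist symmetry of \<open>\<sigma>\<close> is the claimed identity.
\<close>

lemma twist_symmetric_on_summand:
  assumes P: "P \<in> carrier_mat n n" and idem: "P * P = P" and ne: "P \<noteq> 1\<^sub>m n"
    and comm: "\<And>g. g \<in> carrier G \<Longrightarrow> P * \<rho> g = \<rho> g * P"
    and smaller: "\<And>m \<sigma>. m < n \<Longrightarrow> representation G m \<sigma> \<Longrightarrow> twist_symmetric m \<sigma>"
    and g: "g \<in> carrier G"
  shows "P * (e * \<rho> (\<theta> g) * e) = P * (e * \<rho> (inv g) * e)"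
proof -
  define W where "W = {v \<in> carrier_vec n. P *\<^sub>v v = v}"
  have W: "vec_subspace n W"
    using P by (intro vec_subspaceI) (auto simp: W_def mult_add_distrib_mat_vec mult_mat_vec intro!: eq_vecI)
  obtain r B C\<^sub>0 where B: "B \<in> carrier_mat n r" and C0: "C\<^sub>0 \<in> carrier_mat r n" and CB0: "C\<^sub>0 * B = 1\<^sub>m r"
    and BW: "\<And>x. x \<in> carrier_vec r \<Longrightarrow> B *\<^sub>v x \<in> W" and BC0: "\<And>w. w \<in> W \<Longrightarrow> B *\<^sub>v (C\<^sub>0 *\<^sub>v w) = w"
    by (rule subspace_parametrization[OF W]) blast
  \<comment> \<open>\<open>C\<^sub>0\<close> is arbitrary outside the range of \<open>P\<close>; composing with \<open>P\<close> achieves \<open>B C = P\<close>\<close>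
  define C where "C = C\<^sub>0 * P"
  have C: "C \<in> carrier_mat r n" using C0 P by (simp add: C_def)
  have PB: "P * B = B"
    using BW B P by (intro eq_mat_mult_vecI[of _ n r]) (auto simp: W_def assoc_mult_mat_vec[of _ n n _ r])
  have CB: "C * B = 1\<^sub>m r"
    using C0 P B PB CB0 by (simp add: C_def assoc_mult_mat[of _ r n _ n _ r])
  have BC: "B * C = P"
  proof (rule eq_mat_mult_vecI[of _ n n])
    fix v :: "complex vec" assume v: "v \<in> carrier_vec n"
    then have "P *\<^sub>v v \<in> W" using P idem assoc_mult_mat_vec[OF P P v] by (simp add: W_def)
    then show "(B * C) *\<^sub>v v = P *\<^sub>v v"
      using BC0 B C0 P v C
      by (simp add: C_def assoc_mult_mat_vec[of B n r _ n] assoc_mult_mat_vec[of C\<^sub>0 r n _ n])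
  qed (use B C P in auto)
  have "r < n"
  proof (rule ccontr)
    assume "\<not> r < n"
    then have "r = n" using left_inverse_dim_le[OF B C CB] by simp
    then have "B * C = 1\<^sub>m n" using mat_mult_left_right_inverse[of C n B] B C CB by simp
    with BC ne show False by simp
  qed
  define \<sigma> where "\<sigma> x = C * \<rho> x * B" for x
  have CP: "C * P = C" using C0 P idem by (simp add: C_def assoc_mult_mat[of _ r n _ n _ n])
  have compress: "(C * X * B) * (C * Y * B) = C * (X * Y) * B"
    if X: "X \<in> carrier_mat n n" and Y: "Y \<in> carrier_mat n n" and PX: "P * X = X * P" for X Y
  proof -
    have "(C * X * B) * (C * Y * B) = C * (X * (B * C) * Y) * B"
      using X Y B C
      by (simp add: assoc_mult_mat[of _ r n _ n _ r] assoc_mult_mat[of _ r n _ r _ r]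
          assoc_mult_mat[of _ r n _ n _ n] assoc_mult_mat[of _ n r _ n _ n] assoc_mult_mat[of _ n n _ r _ n]
          assoc_mult_mat[of _ n n _ n _ n] assoc_mult_mat[of _ n r _ n _ r] assoc_mult_mat[of _ n n _ n _ r]
          assoc_mult_mat[of _ n n _ r _ r] assoc_mult_mat[of _ r n _ r _ n])
    also have "X * (B * C) * Y = P * (X * Y)" using BC PX X Y P by (simp add: sq_assoc[where n=n, symmetric] del: assoc_mult_mat)
    also have "C * (P * (X * Y)) = C * P * (X * Y)"
      using X Y P C by (simp add: assoc_mult_mat[of C r n P n _ n])
    finally show ?thesis using CP by simp
  qed
  have comm_mult: "P * (X * Y) = X * Y * P"
    if "X \<in> carrier_mat n n" "Y \<in> carrier_mat n n" "P * X = X * P" "P * Y = Y * P" for X Y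
  proof -
    have "P * (X * Y) = X * P * Y" using that P by (simp add: assoc_mult_mat[of P n n X n Y n, symmetric] del: assoc_mult_mat)
    also have "\<dots> = X * (P * Y)" using that P by (simp add: sq_assoc[where n=n])
    finally show ?thesis using that P by (simp add: sq_assoc[where n=n])
  qed
  have comm_e: "P * e = e * P"
    unfolding H_projector_def using P comm
    by (subst mult_mean_mat[of _ n], simp_all, subst mean_mat_mult[of _ n n], simp_all)
       (auto intro: mean_mat_cong)
  have rep': "representation G r \<sigma>"
  proof (rule representationI[OF is_group])
    show "\<sigma> x \<in> carrier_mat r r" if "x \<in> carrier G" for x using that B C by (auto simp: \<sigma>_def)
    show "\<sigma> (x \<otimes> y) = \<sigma> x * \<sigma> y" if "x \<in> carrier G" "y \<in> carrier G" for x y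
      unfolding \<sigma>_def using compress[of "\<rho> x" "\<rho> y"] comm[of x] that by (simp add: rep_mult)
    show "\<sigma> \<one> = 1\<^sub>m r" using B C CB by (simp add: \<sigma>_def rep_one)
  qed
  have proj: "H_projector r \<sigma> = C * e * B"
  proof -
    have "C * e = mean_mat r n H (\<lambda>h. C * \<rho> h)"
      unfolding H_projector_def using C by (intro mult_mean_mat) auto
    also have "\<dots> * B = mean_mat r r H \<sigma>"
      unfolding \<sigma>_def using C B by (intro mean_mat_mult) auto
    finally show ?thesis by (simp add: H_projector_def)
  qed
  have cut: "H_projector r \<sigma> * \<sigma> x * H_projector r \<sigma> = C * (e * \<rho> x * e) * B" if x: "x \<in> carrier G" for x
    unfolding proj \<sigma>_def using x comm_e comm[OF x]
    by (simp add: compress comm_mult sq_carrier[where n=n] del: assoc_mult_mat)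
  have restore: "B * (C * X * B) * C = P * X" if X: "X \<in> carrier_mat n n" and PX: "P * X = X * P" for X
  proof -
    have "B * (C * X * B) * C = (B * C) * X * (B * C)"
      using B C X
      by (simp add: assoc_mult_mat[of _ r n _ n _ r] assoc_mult_mat[of _ n r _ n _ n] assoc_mult_mat[of _ n r _ r _ n]
          assoc_mult_mat[of _ n n _ r _ n] assoc_mult_mat[of _ r n _ r _ n] assoc_mult_mat[of _ n n _ n _ n]
          assoc_mult_mat[of _ r n _ n _ n])
    also have "\<dots> = P * P * X" unfolding BC by (metis P X PX sq_assoc)
    finally show ?thesis using idem by simp
  qed
  have "P * (e * \<rho> x * e) = e * \<rho> x * e * P" if "x \<in> carrier G" for x
    using comm_mult[of "e * \<rho> x" e] comm_mult[of e "\<rho> x"] comm_e comm[OF that] that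
    by (simp add: sq_carrier[where n=n] del: assoc_mult_mat)
  then have restore': "B * (H_projector r \<sigma> * \<sigma> x * H_projector r \<sigma>) * C = P * (e * \<rho> x * e)" if "x \<in> carrier G" for x
    using restore[of "e * \<rho> x * e"] cut[OF that] that by (simp add: sq_carrier[where n=n] del: assoc_mult_mat)
  have "twist_symmetric r \<sigma>" using smaller \<open>r < n\<close> rep' by blast
  from twist_symmetricD[OF this g] show ?thesis
    using restore'[of "\<theta> g"] restore'[of "inv g"] g by simp
qed

text \<open>
  A proper nonzero invariant subspace yields, by Maschke's averaging, an idempotent \<open>P\<close> that commutes
  with the representation and is neither 0 nor 1. Twist symmetry holds on the ranges of \<open>P\<close> and of
  \<open>1 - P\<close>, and these two summands together give the whole space.
\<close>

lemma twist_symmetric_of_reducible: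
  assumes nontriv: "\<not> irreducible_rep G n \<rho>" "n \<noteq> 0"
    and smaller: "\<And>m \<sigma>. m < n \<Longrightarrow> representation G m \<sigma> \<Longrightarrow> twist_symmetric m \<sigma>"
  shows "twist_symmetric n \<rho>"
proof -
  obtain W where W: "vec_subspace n W" and inv: "\<And>g w. g \<in> carrier G \<Longrightarrow> w \<in> W \<Longrightarrow> \<rho> g *\<^sub>v w \<in> W"
    and W0: "W \<noteq> {0\<^sub>v n}" and W1: "W \<noteq> carrier_vec n"
    using nontriv rep unfolding irreducible_rep_def invariant_subspace_def by blast
  note sub = vec_subspaceD[OF W]
  obtain r B C where B: "B \<in> carrier_mat n r" and C: "C \<in> carrier_mat r n" and CB: "C * B = 1\<^sub>m r"
    and BW: "\<And>x. x \<in> carrier_vec r \<Longrightarrow> B *\<^sub>v x \<in> W" and BC: "\<And>w. w \<in> W \<Longrightarrow> B *\<^sub>v (C *\<^sub>v w) = w"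
    by (rule subspace_parametrization[OF W]) blast
  define Q where "Q = B * C"
  have Q: "Q \<in> carrier_mat n n" using B C by (simp add: Q_def)
  have Qv: "Q *\<^sub>v v \<in> W" if "v \<in> carrier_vec n" for v
    using BW[of "C *\<^sub>v v"] that B C by (simp add: Q_def assoc_mult_mat_vec[of B n r C n])
  have Qw: "Q *\<^sub>v w = w" if "w \<in> W" for w
    using BC[OF that] that sub(1) B C by (auto simp: Q_def assoc_mult_mat_vec[of B n r C n])
  have QQ: "Q * (\<rho> g * Q) = \<rho> g * Q" if "g \<in> carrier G" for g
  proof (rule eq_mat_mult_vecI[of _ n n])
    fix v :: "complex vec" assume v: "v \<in> carrier_vec n"
    then show "(Q * (\<rho> g * Q)) *\<^sub>v v = (\<rho> g * Q) *\<^sub>v v"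
      using Qw[OF inv[OF that Qv[OF v]]] Q that by (simp add: sq_assoc_vec[where n=n] sq_carrier[where n=n])
  qed (use that Q in \<open>auto simp: sq_carrier[where n=n]\<close>)
  \<comment> \<open>the average of the conjugates of \<open>Q\<close> commutes with the group and is still a projection onto \<open>W\<close>\<close>
  define F where "F g = \<rho> g * Q * \<rho> (inv g)" for g
  have F: "F g \<in> carrier_mat n n" if "g \<in> carrier G" for g using that Q by (simp add: F_def sq_carrier[where n=n])
  define P where "P = mean_mat n n (carrier G) F"
  have P: "P \<in> carrier_mat n n" by (simp add: P_def)
  have QP: "Q * P = P"
  proof -
    have "Q * F g = F g" if g: "g \<in> carrier G" for g
    proof -
      have "Q * F g = Q * (\<rho> g * Q) * \<rho> (inv g)"
        using g Q by (simp add: F_def sq_assoc[where n=n] sq_carrier[where n=n])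
      then show ?thesis using QQ[OF g] by (simp add: F_def)
    qed
    then show ?thesis
      unfolding P_def using Q F by (simp add: mult_mean_mat[of _ n] cong: mean_mat_cong)
  qed
  have PQ: "P * Q = Q"
  proof -
    have "F g * Q = Q" if g: "g \<in> carrier G" for g
    proof -
      have "F g * Q = \<rho> g * (Q * (\<rho> (inv g) * Q))" using g Q by (simp add: F_def sq_assoc[where n=n])
      also have "\<dots> = (\<rho> g * \<rho> (inv g)) * Q" using g Q QQ[of "inv g"] by (simp add: sq_assoc[where n=n])
      finally show ?thesis using g Q by (simp add: rep_inv)
    qed
    then have "mean_mat n n (carrier G) (\<lambda>g. F g * Q) = Q"
      using finite_carrier Q by (intro mean_mat_const) auto
    then show ?thesis unfolding P_def using Q F by (simp add: mean_mat_mult[of _ n n])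
  qed
  have PP: "P * P = P"
    using QP PQ P Q by (metis sq_assoc)
  have comm: "P * \<rho> x = \<rho> x * P" if x: "x \<in> carrier G" for x
    unfolding P_def F_def using mean_intertwines[OF rep rep Q x] .
  have P1: "P \<noteq> 1\<^sub>m n"
  proof
    assume "P = 1\<^sub>m n"
    then have "Q = 1\<^sub>m n" using QP Q by simp
    then have "carrier_vec n \<subseteq> W" using Qv by force
    then show False using W1 sub(1) by blast
  qed
  have P0: "P \<noteq> 0\<^sub>m n n"
  proof
    assume "P = 0\<^sub>m n n"
    then have "Q = 0\<^sub>m n n" using PQ Q by simp
    then have "w = 0\<^sub>v n" if "w \<in> W" for w
      using Qw[OF that] that sub(1) zero_mat_mult_vec[of w n n] by auto
    then show False using W0 sub(2) by blast
  qed
  define P' where "P' = 1\<^sub>m n - P"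
  have P': "P' \<in> carrier_mat n n" using P by (simp add: P'_def minus_carrier_mat)
  have dist: "P' * X = X - P * X" "X * P' = X - X * P" if "X \<in> carrier_mat n n" for X
    using that P minus_mult_distrib_mat[of "1\<^sub>m n" n n P X n] mult_minus_distrib_mat[of X n n "1\<^sub>m n" n P]
    by (simp_all add: P'_def)
  have sum: "X = P * X + P' * X" if "X \<in> carrier_mat n n" for X
    unfolding dist(1)[OF that] using that P by (auto intro!: eq_matI simp del: index_mult_mat(1))
  have "P' * P' = P'"
    using dist(1)[OF P'] dist(2)[OF P] PP P by (auto simp: P'_def intro!: eq_matI simp del: index_mult_mat(1))
  moreover have "P' \<noteq> 1\<^sub>m n"
  proof
    assume eq: "P' = 1\<^sub>m n"
    have "P = 0\<^sub>m n n"
    proof (rule eq_matI)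
      fix i j assume "i < dim_row (0\<^sub>m n n :: complex mat)" "j < dim_col (0\<^sub>m n n :: complex mat)"
      then show "P $$ (i,j) = 0\<^sub>m n n $$ (i,j)"
        using arg_cong[OF eq, of "\<lambda>M. M $$ (i,j)"] P by (auto simp: P'_def split: if_splits)
    qed (use P in auto)
    with P0 show False by simp
  qed
  moreover have "P' * \<rho> x = \<rho> x * P'" if "x \<in> carrier G" for x
    using dist that comm by simp
  ultimately have "P' * (e * \<rho> (\<theta> g) * e) = P' * (e * \<rho> (inv g) * e)" if "g \<in> carrier G" for g
    using twist_symmetric_on_summand[OF P' _ _ _ smaller that] by blast
  moreover have "P * (e * \<rho> (\<theta> g) * e) = P * (e * \<rho> (inv g) * e)" if "g \<in> carrier G" for g
    using twist_symmetric_on_summand[OF P PP P1 comm smaller that] by blast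
  ultimately show ?thesis
    unfolding twist_symmetric_def using sum[of "e * \<rho> (\<theta> g) * e" for g] sum[of "e * \<rho> (inv g) * e" for g]
    by (metis H_projector_carrier inv_closed rep_carrier sq_carrier theta_closed)
qed

section \<open>Irreducible representations\<close>

lemma invariants_subspace: "vec_subspace n (invariants H n \<rho>)"
  using subspace_invariants[OF is_group subgroup_H rep] .

lemma invariants_carrier: "v \<in> invariants H n \<rho> \<Longrightarrow> v \<in> carrier_vec n"
  by (simp add: invariants_def)

lemma dim_invariants_le_1_iff:
  "dim_invariants H n \<rho> \<le> 1 \<longleftrightarrow> (\<exists>u\<in>invariants H n \<rho>. \<forall>v\<in>invariants H n \<rho>. \<exists>c. v = c \<cdot>\<^sub>v u)"
  unfolding dim_invariants_def by (rule subspace_dim_le_1_iff[OF invariants_subspace])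

lemma compression_scalar:
  assumes dim: "dim_invariants H n \<rho> \<le> 1" and A: "A \<in> carrier_mat n n"
  obtains c where "e * A * e = c \<cdot>\<^sub>m e"
proof -
  obtain u where u: "u \<in> invariants H n \<rho>" and all: "\<And>v. v \<in> invariants H n \<rho> \<Longrightarrow> \<exists>c. v = c \<cdot>\<^sub>v u"
    using dim dim_invariants_le_1_iff by blast
  have uc: "u \<in> carrier_vec n" using invariants_carrier[OF u] .
  obtain c where c: "e *\<^sub>v (A *\<^sub>v u) = c \<cdot>\<^sub>v u"
    using all[OF H_projector_invariant[of "A *\<^sub>v u"]] A uc by auto
  have "e * A * e = c \<cdot>\<^sub>m e"
  proof (rule eq_mat_mult_vecI[of _ n n])
    fix v :: "complex vec" assume v: "v \<in> carrier_vec n"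
    obtain d where d: "e *\<^sub>v v = d \<cdot>\<^sub>v u" using all[OF H_projector_invariant[OF v]] by blast
    have "(e * A * e) *\<^sub>v v = e *\<^sub>v (A *\<^sub>v (e *\<^sub>v v))"
      using A v by (simp add: sq_assoc_vec[where n=n] sq_carrier[where n=n] sq_vec_carrier[where n=n])
    also have "\<dots> = d \<cdot>\<^sub>v (e *\<^sub>v (A *\<^sub>v u))"
      unfolding d using A uc by (simp add: mult_mat_vec[of _ n n])
    also have "\<dots> = c \<cdot>\<^sub>v (e *\<^sub>v v)" unfolding c d by (simp add: smult_smult_assoc mult.commute)
    also have "\<dots> = (c \<cdot>\<^sub>m e) *\<^sub>v v" using v carrier_matD[OF H_projector_carrier[of n \<rho>]] by (auto intro!: eq_vecI)
    finally show "(e * A * e) *\<^sub>v v = (c \<cdot>\<^sub>m e) *\<^sub>v v" .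
  qed (use A in \<open>auto simp: sq_carrier[where n=n]\<close>)
  then show thesis by (rule that)
qed

text \<open>
  An isomorphism \<open>T\<close> from \<open>\<rho> \<circ> \<theta>\<close> to the dual takes the projector \<open>e\<close> of \<open>\<rho> \<circ> \<theta>\<close> (\<open>\<theta>\<close> permutes \<open>H\<close>) to
  the projector of the dual, which is the transpose of \<open>e\<close>. Hence it takes \<open>e \<rho>(\<theta> g) e\<close> to the transpose
  of \<open>e \<rho>(g\<^sup>-\<^sup>1) e\<close>. Both are multiples of \<open>e\<close> by one-dimensionality, so the two scalars agree.
\<close>

lemma twist_symmetric_of_dual:
  assumes dim: "dim_invariants H n \<rho> \<le> 1"
    and iso: "distinguished H n \<rho> \<Longrightarrow> rep_iso G n (\<rho> \<circ> \<theta>) n (dual_rep G \<rho>)"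
  shows "twist_symmetric n \<rho>"
proof (cases "distinguished H n \<rho>")
  case False
  then have "e = 0\<^sub>m n n"
    using H_projector_invariant
    by (intro eq_mat_mult_vecI[of _ n n]) (auto simp: distinguished_def)
  then show ?thesis
    by (simp add: twist_symmetric_def left_mult_zero_mat[of _ n n n])
next
  case True
  then obtain T where T: "T \<in> carrier_mat n n" and bij: "bij_betw (\<lambda>v. T *\<^sub>v v) (carrier_vec n) (carrier_vec n)"
    and inter: "\<And>g. g \<in> carrier G \<Longrightarrow> T * \<rho> (\<theta> g) = (\<rho> (inv g))\<^sup>T * T"
    using iso by (auto simp: rep_iso_def dual_rep_def)
  have Te: "T * e = e\<^sup>T * T"
  proof -
    have "T * e = mean_mat n n H (\<lambda>h. T * \<rho> (\<theta> h))"
      unfolding H_projector_def mean_mat_reindex[OF bij_theta_H, of n n \<rho>, symmetric]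
      using T by (intro mult_mean_mat) auto
    also have "\<dots> = mean_mat n n H (\<lambda>h. (\<rho> (inv h))\<^sup>T * T)"
      by (intro mean_mat_cong inter) simp
    also have "\<dots> = mean_mat n n H (\<lambda>h. (\<rho> (inv h))\<^sup>T) * T"
      using T by (intro mean_mat_mult[symmetric]) auto
    also have "mean_mat n n H (\<lambda>h. (\<rho> (inv h))\<^sup>T) = (mean_mat n n H (\<lambda>h. \<rho> (inv h)))\<^sup>T"
      by (intro transpose_mean_mat[symmetric]) auto
    also have "mean_mat n n H (\<lambda>h. \<rho> (inv h)) = e"
      unfolding H_projector_def by (rule mean_mat_reindex[OF bij_inv_H])
    finally show ?thesis .
  qed
  show ?thesis
    unfolding twist_symmetric_def
  proof
    fix g assume g: "g \<in> carrier G"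
    obtain a where a: "e * \<rho> (\<theta> g) * e = a \<cdot>\<^sub>m e" using compression_scalar[OF dim] g by (metis rep_carrier theta_closed)
    obtain b where b: "e * \<rho> (inv g) * e = b \<cdot>\<^sub>m e" using compression_scalar[OF dim] g by (metis rep_carrier inv_closed)
    have "a \<cdot>\<^sub>m (T * e) = T * (e * \<rho> (\<theta> g) * e)"
      unfolding a using T by (simp add: mult_smult_distrib[of _ n n _ n])
    also have "\<dots> = (T * e) * \<rho> (\<theta> g) * e"
      using T g by (simp add: sq_assoc[where n=n] sq_carrier[where n=n])
    also have "\<dots> = e\<^sup>T * (T * \<rho> (\<theta> g)) * e"
      unfolding Te using T g by (simp add: sq_assoc[where n=n] sq_carrier[where n=n])
    also have "\<dots> = e\<^sup>T * (\<rho> (inv g))\<^sup>T * (T * e)"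
      unfolding inter[OF g] using T g by (simp add: sq_assoc[where n=n] sq_carrier[where n=n])
    also have "\<dots> = (e * \<rho> (inv g) * e)\<^sup>T * T"
      unfolding Te using T g
      by (simp add: sq_assoc[where n=n] sq_carrier[where n=n] transpose_mult[of _ n n _ n])
    also have "\<dots> = b \<cdot>\<^sub>m (e\<^sup>T * T)"
    proof -
      have "(b \<cdot>\<^sub>m e)\<^sup>T = b \<cdot>\<^sub>m e\<^sup>T" by (auto intro!: eq_matI)
      then show ?thesis unfolding b using T by (simp add: mult_smult_assoc_mat[of _ n n _ n])
    qed
    finally have ab: "a \<cdot>\<^sub>m (T * e) = b \<cdot>\<^sub>m (T * e)" unfolding Te .
    have "a = b"
    proof (rule ccontr)
      assume "a \<noteq> b"
      then have Te0: "(T * e) $$ (i,j) = 0" if "i < n" "j < n" for i j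
        using arg_cong[OF ab, of "\<lambda>M. M $$ (i,j)"] that T carrier_matD[OF H_projector_carrier[of n \<rho>]]
        by (simp del: index_mult_mat(1))
      have "T * e = 0\<^sub>m n n"
        using T Te0 carrier_matD[OF H_projector_carrier[of n \<rho>]] by (intro eq_matI) (auto simp del: index_mult_mat(1))
      then have "T *\<^sub>v (e *\<^sub>v v) = T *\<^sub>v 0\<^sub>v n" if "v \<in> carrier_vec n" for v
        using that T assoc_mult_mat_vec[OF T H_projector_carrier that, symmetric] by (auto intro!: eq_vecI)
      then have "e *\<^sub>v v = 0\<^sub>v n" if "v \<in> carrier_vec n" for v
        using that bij mult_mat_vec_carrier[OF H_projector_carrier that, of \<rho>] unfolding bij_betw_def inj_on_def
        by (metis zero_carrier_vec)
      then have "invariants H n \<rho> \<subseteq> {0\<^sub>v n}" using H_projector_fixes invariants_carrier by force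
      then show False using True vec_subspaceD(2)[OF invariants_subspace] by (auto simp: distinguished_def)
    qed
    then show "e * \<rho> (\<theta> g) * e = e * \<rho> (inv g) * e" using a b by simp
  qed
qed

lemma compression_mult:
  assumes "x \<in> carrier G" "y \<in> carrier G"
  shows "(e * \<rho> x * e) * (e * \<rho> y * e) = mean_mat n n H (\<lambda>h. e * \<rho> (x \<otimes> h \<otimes> y) * e)"
proof -
  have "(e * \<rho> x * e) * (e * \<rho> y * e) = (e * \<rho> x) * (e * e) * (\<rho> y * e)"
    using assms by (simp add: sq_assoc[where n=n] sq_carrier[where n=n])
  also have "\<dots> = (e * \<rho> x) * mean_mat n n H \<rho> * (\<rho> y * e)"
    unfolding H_projector_idem by (simp add: H_projector_def)
  also have "(e * \<rho> x) * mean_mat n n H \<rho> = mean_mat n n H (\<lambda>h. e * \<rho> x * \<rho> h)"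
    using assms by (intro mult_mean_mat) (auto simp: sq_carrier[where n=n])
  also have "\<dots> * (\<rho> y * e) = mean_mat n n H (\<lambda>h. e * \<rho> x * \<rho> h * (\<rho> y * e))"
    using assms by (intro mean_mat_mult) (auto simp: sq_carrier[where n=n])
  also have "\<dots> = mean_mat n n H (\<lambda>h. e * \<rho> (x \<otimes> h \<otimes> y) * e)"
    using assms by (intro mean_mat_cong) (simp add: rep_mult sq_assoc[where n=n] sq_carrier[where n=n])
  finally show ?thesis .
qed

text \<open>
  Twist symmetry says that \<open>z\<close> may be replaced by \<open>\<theta>(z\<^sup>-\<^sup>1)\<close> in \<open>e \<rho>(z) e\<close>. Applied to the products
  \<open>x h y\<close> that make up the left-hand side this reverses the order of the factors, and \<open>h \<mapsto> \<theta>(h\<^sup>-\<^sup>1)\<close>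
  permutes \<open>H\<close>.
\<close>

lemma compressions_commute:
  assumes sym: "twist_symmetric n \<rho>" and x: "x \<in> carrier G" and y: "y \<in> carrier G"
  shows "(e * \<rho> x * e) * (e * \<rho> y * e) = (e * \<rho> y * e) * (e * \<rho> x * e)"
proof -
  have flip: "e * \<rho> z * e = e * \<rho> (\<theta> (inv z)) * e" if "z \<in> carrier G" for z
    using twist_symmetricD[OF sym, of "inv z"] that by simp
  have "(e * \<rho> x * e) * (e * \<rho> y * e) = mean_mat n n H (\<lambda>h. e * \<rho> (\<theta> (inv (x \<otimes> h \<otimes> y))) * e)"
    unfolding compression_mult[OF x y] using x y by (intro mean_mat_cong flip) simp
  also have "\<dots> = mean_mat n n H (\<lambda>h. e * \<rho> (\<theta> (inv y) \<otimes> \<theta> (inv h) \<otimes> \<theta> (inv x)) * e)"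
    using x y by (intro mean_mat_cong) (simp add: inv_mult_group theta_mult m_assoc)
  also have "\<dots> = mean_mat n n H (\<lambda>h. e * \<rho> (\<theta> (inv y) \<otimes> h \<otimes> \<theta> (inv x)) * e)"
    using mean_mat_reindex[OF bij_betw_trans[OF bij_inv_H bij_theta_H], of n n
        "\<lambda>h. e * \<rho> (\<theta> (inv y) \<otimes> h \<otimes> \<theta> (inv x)) * e"]
    by (simp add: comp_def)
  also have "\<dots> = (e * \<rho> y * e) * (e * \<rho> x * e)"
    unfolding flip[OF x] flip[OF y] using x y by (intro compression_mult[symmetric]) auto
  finally show ?thesis .
qed

text \<open>
  The matrices \<open>e \<rho>(x) e\<close> preserve the space of invariants and commute, so they have a common
  eigenvector \<open>w\<close> there. The vectors \<open>v\<close> for which \<open>e\<close> maps the whole orbit of \<open>v\<close> into the line of \<open>w\<close>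
  form an invariant subspace that contains \<open>w\<close>; by irreducibility it is everything, so \<open>e\<close> has range in
  that line.
\<close>

lemma dim_invariants_of_twist_symmetric:
  assumes irr: "irreducible_rep G n \<rho>" and sym: "twist_symmetric n \<rho>"
  shows "dim_invariants H n \<rho> \<le> 1"
proof (cases "invariants H n \<rho> = {0\<^sub>v n}")
  case True
  have "\<exists>c. 0\<^sub>v n = c \<cdot>\<^sub>v (0\<^sub>v n :: complex vec)" by (rule exI[of _ 0]) (auto intro!: eq_vecI)
  then show ?thesis unfolding dim_invariants_le_1_iff True by simp
next
  case False
  have "\<exists>w\<in>invariants H n \<rho>. w \<noteq> 0\<^sub>v n \<and> (\<forall>x\<in>carrier G. \<exists>c. (e * \<rho> x * e) *\<^sub>v w = c \<cdot>\<^sub>v w)"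
  proof (rule common_eigenvector[OF finite_carrier invariants_subspace False])
    fix x assume x: "x \<in> carrier G"
    then show M: "e * \<rho> x * e \<in> carrier_mat n n" by (simp add: sq_carrier[where n=n])
    fix w assume w: "w \<in> invariants H n \<rho>"
    note wc = invariants_carrier[OF w]
    have "(e * \<rho> x * e) *\<^sub>v w = e *\<^sub>v (\<rho> x *\<^sub>v (e *\<^sub>v w))"
      using x wc by (simp add: sq_assoc_vec[where n=n] sq_carrier[where n=n] sq_vec_carrier[where n=n])
    then show "(e * \<rho> x * e) *\<^sub>v w \<in> invariants H n \<rho>"
      using H_projector_invariant[of "\<rho> x *\<^sub>v (e *\<^sub>v w)"] x wc mult_mat_vec_carrier[OF H_projector_carrier wc]
        mult_mat_vec_carrier[OF rep_carrier[OF x]] by simp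
    fix y assume y: "y \<in> carrier G"
    show "(e * \<rho> x * e) *\<^sub>v ((e * \<rho> y * e) *\<^sub>v w) = (e * \<rho> y * e) *\<^sub>v ((e * \<rho> x * e) *\<^sub>v w)"
      using compressions_commute[OF sym x y] M wc y
        assoc_mult_mat_vec[of "e * \<rho> x * e" n n "e * \<rho> y * e" n w] assoc_mult_mat_vec[of "e * \<rho> y * e" n n "e * \<rho> x * e" n w]
      by (simp add: sq_carrier[where n=n] del: assoc_mult_mat_vec assoc_mult_mat)
  qed
  then obtain w where w: "w \<in> invariants H n \<rho>" "w \<noteq> 0\<^sub>v n"
    and ev: "\<And>x. x \<in> carrier G \<Longrightarrow> \<exists>c. (e * \<rho> x * e) *\<^sub>v w = c \<cdot>\<^sub>v w" by blast
  have wc: "w \<in> carrier_vec n" using invariants_carrier[OF w(1)] .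
  define U where "U = {v \<in> carrier_vec n. \<forall>x\<in>carrier G. \<exists>c. e *\<^sub>v (\<rho> x *\<^sub>v v) = c \<cdot>\<^sub>v w}"
  have "vec_subspace n U"
  proof (rule vec_subspaceI)
    show "U \<subseteq> carrier_vec n" by (auto simp: U_def)
    have "e *\<^sub>v (\<rho> x *\<^sub>v 0\<^sub>v n) = 0 \<cdot>\<^sub>v w" if "x \<in> carrier G" for x
      using that wc by (auto simp: mat_mult_zero_vec[of _ n n] intro!: eq_vecI)
    then show "0\<^sub>v n \<in> U" by (auto simp: U_def)
    fix u v c assume u: "u \<in> U" and v: "v \<in> U"
    have "\<exists>d. e *\<^sub>v (\<rho> x *\<^sub>v (u + v)) = d \<cdot>\<^sub>v w" "\<exists>d. e *\<^sub>v (\<rho> x *\<^sub>v (c \<cdot>\<^sub>v u)) = d \<cdot>\<^sub>v w"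
      if x: "x \<in> carrier G" for x
    proof -
      obtain a b where ab: "e *\<^sub>v (\<rho> x *\<^sub>v u) = a \<cdot>\<^sub>v w" "e *\<^sub>v (\<rho> x *\<^sub>v v) = b \<cdot>\<^sub>v w"
        using u v x unfolding U_def by blast
      have uv: "u \<in> carrier_vec n" "v \<in> carrier_vec n" using u v by (auto simp: U_def)
      have "e *\<^sub>v (\<rho> x *\<^sub>v (u + v)) = (a + b) \<cdot>\<^sub>v w"
        using ab uv x by (simp add: mult_add_distrib_mat_vec[of _ n n] add_smult_distrib_vec sq_vec_carrier[where n=n])
      moreover have "e *\<^sub>v (\<rho> x *\<^sub>v (c \<cdot>\<^sub>v u)) = (c * a) \<cdot>\<^sub>v w"
        using ab uv x by (simp add: mult_mat_vec[of _ n n] smult_smult_assoc sq_vec_carrier[where n=n])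
      ultimately show "\<exists>d. e *\<^sub>v (\<rho> x *\<^sub>v (u + v)) = d \<cdot>\<^sub>v w" "\<exists>d. e *\<^sub>v (\<rho> x *\<^sub>v (c \<cdot>\<^sub>v u)) = d \<cdot>\<^sub>v w"
        by blast+
    qed
    then show "u + v \<in> U" "c \<cdot>\<^sub>v u \<in> U" using u v by (auto simp: U_def)
  qed
  moreover have "\<rho> g *\<^sub>v v \<in> U" if g: "g \<in> carrier G" and v: "v \<in> U" for g v
  proof -
    have vc: "v \<in> carrier_vec n" using v by (simp add: U_def)
    have "\<rho> x *\<^sub>v (\<rho> g *\<^sub>v v) = \<rho> (x \<otimes> g) *\<^sub>v v" if "x \<in> carrier G" for x
      using that g vc by (simp add: rep_mult assoc_mult_mat_vec[of _ n n _ n])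
    then show ?thesis using v g mult_mat_vec_carrier[OF rep_carrier[OF g] vc] by (simp add: U_def)
  qed
  moreover have "w \<in> U"
  proof -
    have "(e * \<rho> x * e) *\<^sub>v w = e *\<^sub>v (\<rho> x *\<^sub>v w)" if "x \<in> carrier G" for x
      using that wc H_projector_fixes[OF w(1)] by (simp add: sq_assoc_vec[where n=n] sq_carrier[where n=n])
    then show ?thesis using ev wc by (simp add: U_def)
  qed
  ultimately have U: "U = carrier_vec n"
    using irr w(2) unfolding irreducible_rep_def invariant_subspace_def by blast
  have "\<exists>c. v = c \<cdot>\<^sub>v w" if v: "v \<in> invariants H n \<rho>" for v
  proof -
    have vc: "v \<in> carrier_vec n" using invariants_carrier[OF v] .
    then have "\<exists>c. e *\<^sub>v (\<rho> \<one> *\<^sub>v v) = c \<cdot>\<^sub>v w" using U by (auto simp: U_def)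
    then show ?thesis using vc H_projector_fixes[OF v] by (simp add: rep_one)
  qed
  then show ?thesis unfolding dim_invariants_le_1_iff using w(1) by blast
qed

text \<open>
  Averaging \<open>\<rho>(g\<^sup>-\<^sup>1)\<^sup>T A \<rho>(\<theta>(g\<^sup>-\<^sup>1))\<close> over \<open>g\<close> gives an intertwiner \<open>T\<close> for every matrix \<open>A\<close>. For
  \<open>A = e\<^sup>T X e\<close> twist symmetry gives \<open>e\<^sup>T T e = c e\<^sup>T X e\<close>, where \<open>c\<close> is the mean of
  \<open>\<phi>(g) \<phi>(g\<^sup>-\<^sup>1)\<close> and \<open>e \<rho>(x) e = \<phi>(x) e\<close>. So \<open>T\<close> is nonzero for a suitable \<open>X\<close> once \<open>c\<close> is nonzero.
  To see this, let \<open>S\<close> be the average of the conjugates of \<open>e\<close>. By Schur's lemma \<open>S = s 1\<close>, where \<open>s\<close> is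
  nonzero because \<open>S\<close> has the same trace 1 as the rank-one idempotent \<open>e\<close>; and \<open>e S e = c e\<close> shows that
  \<open>c = s\<close>. Finally, the kernel of \<open>T\<close> is invariant, hence zero.
\<close>

lemma dual_of_twist_symmetric:
  assumes irr: "irreducible_rep G n \<rho>" and sym: "twist_symmetric n \<rho>" and dist: "distinguished H n \<rho>"
  shows "rep_iso G n (\<rho> \<circ> \<theta>) n (dual_rep G \<rho>)"
proof -
  have dim: "dim_invariants H n \<rho> \<le> 1" using dim_invariants_of_twist_symmetric[OF irr sym] .
  obtain u where u: "u \<in> invariants H n \<rho>" and all: "\<And>v. v \<in> invariants H n \<rho> \<Longrightarrow> \<exists>c. v = c \<cdot>\<^sub>v u"
    using dim dim_invariants_le_1_iff by blast
  have uc: "u \<in> carrier_vec n" using invariants_carrier[OF u] .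
  have e_dim [simp]: "dim_row e = n" "dim_col e = n" using carrier_matD[OF H_projector_carrier[of n \<rho>]] by auto
  have e0: "e \<noteq> 0\<^sub>m n n"
  proof
    assume "e = 0\<^sub>m n n"
    then have "invariants H n \<rho> \<subseteq> {0\<^sub>v n}"
      using H_projector_fixes zero_mat_mult_vec[OF invariants_carrier] by (metis singletonI subsetI)
    then show False using dist vec_subspaceD(2)[OF invariants_subspace] by (auto simp: distinguished_def)
  qed
  have nonzero_entry: "\<exists>i<n. \<exists>j<n. e $$ (i,j) \<noteq> 0"
  proof (rule ccontr)
    assume "\<not> ?thesis"
    then have "e = 0\<^sub>m n n" by (intro eq_matI) auto
    with e0 show False ..
  qed
  have eq_of_smult_e: "a = b" if "a \<cdot>\<^sub>m e = b \<cdot>\<^sub>m e" for a b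
  proof -
    obtain i j where "i < n" "j < n" "e $$ (i,j) \<noteq> 0" using nonzero_entry by blast
    then show ?thesis using arg_cong[OF that, of "\<lambda>M. M $$ (i,j)"] by simp
  qed
  have trace_e: "mat_trace e = 1"
  proof -
    have "\<exists>c. col e j = c \<cdot>\<^sub>v u" if "j < n" for j
    proof -
      have "e *\<^sub>v unit_vec n j = col e j" using that by (auto intro!: eq_vecI)
      then show ?thesis using all[OF H_projector_invariant[of "unit_vec n j"]] by simp
    qed
    then obtain q where q: "\<And>j. j < n \<Longrightarrow> col e j = q j \<cdot>\<^sub>v u" by metis
    have entry: "e $$ (i,j) = q j * u $ i" if "i < n" "j < n" for i j
      using arg_cong[OF q[OF that(2)], of "\<lambda>v. v $ i"] that uc by simp
    \<comment> \<open>true of every matrix of rank one\<close>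
    have "e * e = mat_trace e \<cdot>\<^sub>m e"
    proof (rule eq_matI)
      fix i j assume "i < dim_row (mat_trace e \<cdot>\<^sub>m e)" "j < dim_col (mat_trace e \<cdot>\<^sub>m e)"
      then have ij: "i < n" "j < n" by auto
      have "(e * e) $$ (i,j) = (\<Sum>k\<in>{0..<n}. e $$ (k,k) * e $$ (i,j))"
        using ij by (subst mat_mult_index[of _ n n _ n]) (auto simp: entry intro!: sum.cong)
      then show "(e * e) $$ (i,j) = (mat_trace e \<cdot>\<^sub>m e) $$ (i,j)"
        using ij by (simp add: mat_trace_def sum_distrib_right)
    qed auto
    then have "1 \<cdot>\<^sub>m e = mat_trace e \<cdot>\<^sub>m e" using H_projector_idem by (auto intro!: eq_matI)
    then show ?thesis using eq_of_smult_e by metis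
  qed
  have "\<exists>c. e * \<rho> x * e = c \<cdot>\<^sub>m e" if "x \<in> carrier G" for x
    by (rule compression_scalar[OF dim rep_carrier[OF that]]) blast
  then obtain \<phi> where \<phi>: "\<And>x. x \<in> carrier G \<Longrightarrow> e * \<rho> x * e = \<phi> x \<cdot>\<^sub>m e"
    by metis
  define c where "c = (\<Sum>g\<in>carrier G. \<phi> g * \<phi> (inv g)) / of_nat (card (carrier G))"
  have ne: "carrier G \<noteq> {}" using one_closed by auto
  have c0: "c \<noteq> 0"
  proof -
    define F where "F g = \<rho> g * e * \<rho> (inv g)" for g
    have F: "F g \<in> carrier_mat n n" if "g \<in> carrier G" for g using that by (simp add: F_def sq_carrier[where n=n])
    define S where "S = mean_mat n n (carrier G) F"
    have "S * \<rho> x = \<rho> x * S" if x: "x \<in> carrier G" for x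
      unfolding S_def F_def using mean_intertwines[OF rep rep H_projector_carrier x] .
    then obtain s where s: "S = s \<cdot>\<^sub>m 1\<^sub>m n"
      using schur[OF irr rep_carrier, of S] by (auto simp: S_def)
    have "mat_trace (F g) = 1" if g: "g \<in> carrier G" for g
    proof -
      have "mat_trace (F g) = mat_trace (\<rho> (inv g) * (\<rho> g * e))"
        unfolding F_def using g by (intro mat_trace_comm[of _ n n]) (auto simp: sq_carrier[where n=n])
      also have "\<rho> (inv g) * (\<rho> g * e) = (\<rho> (inv g) * \<rho> g) * e" using g by (simp add: sq_assoc[where n=n])
      finally show ?thesis using g trace_e by (simp add: rep_inv)
    qed
    then have "mat_trace S = 1"
      unfolding S_def using finite_carrier ne F by (intro mat_trace_mean_mat) auto
    then have "s \<noteq> 0" by (auto simp: s mat_trace_def)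
    have "e * S * e = mean_mat n n (carrier G) (\<lambda>g. e * F g * e)"
      unfolding S_def using F
      by (simp add: mult_mean_mat[of _ n n] mean_mat_mult[of _ n n] sq_carrier[where n=n])
    also have "\<dots> = c \<cdot>\<^sub>m e"
      unfolding c_def
    proof (rule mean_mat_smult)
      fix g assume g: "g \<in> carrier G"
      have "e * F g * e = (e * \<rho> g) * (e * e) * (\<rho> (inv g) * e)"
        unfolding H_projector_idem F_def using g
        by (simp add: sq_assoc[where n=n] sq_carrier[where n=n])
      also have "\<dots> = (e * \<rho> g * e) * (e * \<rho> (inv g) * e)"
        using g by (simp add: sq_assoc[where n=n] sq_carrier[where n=n])
      also have "\<dots> = (\<phi> g * \<phi> (inv g)) \<cdot>\<^sub>m (e * e)"
        using g by (simp add: \<phi> mult_smult_distrib[of _ n n _ n] mult_smult_assoc_mat[of _ n n _ n] smult_smult_mat mult.commute)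
      finally show "e * F g * e = (\<phi> g * \<phi> (inv g)) \<cdot>\<^sub>m e" unfolding H_projector_idem .
    qed simp
    finally have "c \<cdot>\<^sub>m e = e * (s \<cdot>\<^sub>m 1\<^sub>m n) * e" by (simp add: s)
    also have "\<dots> = s \<cdot>\<^sub>m (e * e)"
      by (simp add: mult_smult_distrib[of _ n n _ n] mult_smult_assoc_mat[of _ n n _ n])
    finally have "c = s" unfolding H_projector_idem by (rule eq_of_smult_e)
    with \<open>s \<noteq> 0\<close> show ?thesis by simp
  qed
  obtain k l where kl: "k < n" "l < n" "e $$ (k,l) \<noteq> 0" using nonzero_entry by blast
  \<comment> \<open>the matrix unit at \<open>(k,k)\<close>: the entry of \<open>e\<^sup>T X e\<close> at \<open>(l,l)\<close> is then the square of a nonzero number\<close>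
  define X where "X = mat n n (\<lambda>(i,j). if i = k \<and> j = k then 1 else (0::complex))"
  have X: "X \<in> carrier_mat n n" by (simp add: X_def)
  \<comment> \<open>these are the summands of \<open>mean_intertwines\<close> for \<open>\<rho> \<circ> \<theta>\<close> and the dual of \<open>\<rho>\<close>\<close>
  define F where "F g = (\<rho> (inv g))\<^sup>T * (e\<^sup>T * X * e) * \<rho> (\<theta> (inv g))" for g
  have F: "F g \<in> carrier_mat n n" if "g \<in> carrier G" for g
    using that X by (simp add: F_def sq_carrier[where n=n])
  define T where "T = mean_mat n n (carrier G) F"
  have T: "T \<in> carrier_mat n n" by (simp add: T_def)
  have inter: "T * \<rho> (\<theta> x) = (\<rho> (inv x))\<^sup>T * T" if x: "x \<in> carrier G" for x
    using mean_intertwines[OF representation_comp_theta[OF rep] representation_dual[OF rep] _ x, of "e\<^sup>T * X * e"] X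
    by (simp add: T_def F_def[abs_def] dual_rep_def sq_carrier[where n=n])
  have T0: "T \<noteq> 0\<^sub>m n n"
  proof
    assume "T = 0\<^sub>m n n"
    then have "0\<^sub>m n n = e\<^sup>T * T * e" by (simp add: left_mult_zero_mat[of _ n n] right_mult_zero_mat[of _ n n])
    also have "\<dots> = mean_mat n n (carrier G) (\<lambda>g. e\<^sup>T * F g * e)"
      unfolding T_def using F
      by (simp add: mult_mean_mat[of _ n n] mean_mat_mult[of _ n n] sq_carrier[where n=n])
    also have "\<dots> = c \<cdot>\<^sub>m (e\<^sup>T * X * e)"
      unfolding c_def
    proof (rule mean_mat_smult)
      fix g assume g: "g \<in> carrier G"
      have "e\<^sup>T * F g * e = (e * \<rho> (inv g) * e)\<^sup>T * X * (e * \<rho> (\<theta> (inv g)) * e)"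
        using g X by (simp add: F_def transpose_mult[of _ n n _ n] sq_assoc[where n=n] sq_carrier[where n=n])
      also have "e * \<rho> (\<theta> (inv g)) * e = \<phi> g \<cdot>\<^sub>m e"
        using twist_symmetricD[OF sym, of "inv g"] g \<phi>[OF g] by simp
      also have "(e * \<rho> (inv g) * e)\<^sup>T = \<phi> (inv g) \<cdot>\<^sub>m e\<^sup>T"
        using g by (subst \<phi>) (auto intro!: eq_matI)
      finally show "e\<^sup>T * F g * e = (\<phi> g * \<phi> (inv g)) \<cdot>\<^sub>m (e\<^sup>T * X * e)"
        using X by (simp add: mult_smult_distrib[of _ n n _ n] mult_smult_assoc_mat[of _ n n _ n] sq_carrier[where n=n]
            smult_smult_mat mult.commute)
    qed (use X in \<open>simp add: sq_carrier[where n=n]\<close>)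
    finally have "0\<^sub>m n n = c \<cdot>\<^sub>m (e\<^sup>T * X * e)" .
    from arg_cong[OF this, of "\<lambda>M. M $$ (l,l)"] have "c * (e\<^sup>T * X * e) $$ (l,l) = 0"
      using kl X by (simp del: index_mult_mat(1))
    moreover have "(e\<^sup>T * X * e) $$ (l,l) = e $$ (k,l) * e $$ (k,l)"
    proof -
      have eX: "(e\<^sup>T * X) $$ (l,j) = (if j = k then e $$ (k,l) else 0)" if "j < n" for j
        using that kl X by (subst mat_mult_index[of _ n n _ n]) (auto simp: X_def if_distrib cong: if_cong)
      show ?thesis
        using kl X by (subst mat_mult_index[of _ n n _ n]) (auto simp: eX sq_carrier[where n=n] if_distrib[of "\<lambda>a. a * _"] cong: if_cong simp del: index_mult_mat(1))
    qed
    ultimately show False using kl(3) c0 by simp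
  qed
  define W where "W = {v \<in> carrier_vec n. T *\<^sub>v v = 0\<^sub>v n}"
  have "vec_subspace n W"
    using T by (intro vec_subspaceI) (auto simp: W_def mult_add_distrib_mat_vec mult_mat_vec intro!: eq_vecI)
  moreover have "\<rho> g *\<^sub>v v \<in> W" if g: "g \<in> carrier G" and v: "v \<in> W" for g v
  proof -
    have vc: "v \<in> carrier_vec n" and Tv: "T *\<^sub>v v = 0\<^sub>v n" using v by (auto simp: W_def)
    have "T *\<^sub>v (\<rho> g *\<^sub>v v) = (T * \<rho> (\<theta> (\<theta> g))) *\<^sub>v v" using g vc T by (simp add: theta_theta sq_assoc_vec[where n=n])
    also have "\<dots> = (\<rho> (inv (\<theta> g)))\<^sup>T *\<^sub>v (T *\<^sub>v v)"
      using inter[of "\<theta> g"] g vc T by (simp add: sq_assoc_vec[where n=n])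
    also have "\<dots> = 0\<^sub>v n" unfolding Tv using g by (simp add: mat_mult_zero_vec[of _ n n])
    finally show ?thesis using g vc mult_mat_vec_carrier[OF rep_carrier[OF g] vc] by (simp add: W_def)
  qed
  moreover have "W \<noteq> carrier_vec n"
  proof
    assume "W = carrier_vec n"
    then have "T = 0\<^sub>m n n"
      using T by (intro eq_mat_mult_vecI[of _ n n]) (auto simp: W_def zero_mat_mult_vec)
    with T0 show False ..
  qed
  ultimately have "W = {0\<^sub>v n}"
    using irr unfolding irreducible_rep_def invariant_subspace_def by blast
  then have "bij_betw (\<lambda>v. T *\<^sub>v v) (carrier_vec n) (carrier_vec n)"
    using T by (intro bij_of_trivial_kernel) (auto simp: W_def)
  then show ?thesis using T inter unfolding rep_iso_def dual_rep_def by auto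
qed

end

lemma twist_symmetric_of_irreducibles:
  assumes irr: "\<And>n \<rho>. irreducible_rep G n \<rho> \<Longrightarrow> twist_symmetric n \<rho>"
    and rep: "representation G n \<rho>"
  shows "twist_symmetric n \<rho>"
  using rep
proof (induction n arbitrary: \<rho> rule: less_induct)
  case (less n)
  show ?case
  proof (cases "irreducible_rep G n \<rho> \<or> n = 0")
    case True
    then show ?thesis
    proof
      assume "n = 0"
      then have "A = B" if "A \<in> carrier_mat n n" "B \<in> carrier_mat n n" for A B :: "complex mat"
        using that by (auto intro!: eq_matI)
      then show ?thesis unfolding twist_symmetric_def using rep_carrier[OF less.prems]
        by (metis H_projector_carrier inv_closed sq_carrier theta_closed)
    qed (rule irr)
  next
    case False
    then show ?thesis using twist_symmetric_of_reducible[OF less.prems] less.IH by blast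
  qed
qed

section \<open>The regular representation\<close>

text \<open>
  In the regular representation the entry of \<open>e \<rho>(x) e\<close> in row \<open>g\<^sup>-\<^sup>1\<close> and column \<open>1\<close> counts, up to a
  factor, the pairs \<open>(h, k)\<close> in \<open>H \<times> H\<close> with \<open>h x k = g\<^sup>-\<^sup>1\<close>. It is nonzero for \<open>x = g\<^sup>-\<^sup>1\<close>, hence by twist
  symmetry also for \<open>x = \<theta> g\<close>.
\<close>

lemma double_cosets_of_regular:
  assumes all: "\<And>n \<rho>. representation G n \<rho> \<Longrightarrow> twist_symmetric n \<rho>" and g: "g \<in> carrier G"
  shows "\<exists>h\<^sub>1\<in>H. \<exists>h\<^sub>2\<in>H. h\<^sub>1 \<otimes> inv g \<otimes> h\<^sub>2 = \<theta> g"
proof -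
  define n where "n = card (carrier G)"
  obtain f where f: "bij_betw f {0..<n} (carrier G)"
    using ex_bij_betw_nat_finite[OF finite_carrier] unfolding n_def by blast
  have fc: "f i \<in> carrier G" if "i < n" for i using f that by (auto simp: bij_betw_def)
  have f_inj: "f i = f j \<longleftrightarrow> i = j" if "i < n" "j < n" for i j
    using f that by (auto simp: bij_betw_def inj_on_def)
  have f_surj: "\<exists>i<n. f i = x" if "x \<in> carrier G" for x
    using f that by (force simp: bij_betw_def image_iff)
  define \<rho> where "\<rho> x = mat n n (\<lambda>(i,j). if f i = x \<otimes> f j then 1 else (0::complex))" for x
  have rep: "representation G n \<rho>"
  proof (rule representationI[OF is_group])
    show "\<rho> x \<in> carrier_mat n n" for x by (simp add: \<rho>_def)
    show "\<rho> \<one> = 1\<^sub>m n" using fc f_inj by (auto simp: \<rho>_def intro!: eq_matI)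
    fix x y assume xy: "x \<in> carrier G" "y \<in> carrier G"
    show "\<rho> (x \<otimes> y) = \<rho> x * \<rho> y"
    proof (rule eq_matI)
      fix i j assume "i < dim_row (\<rho> x * \<rho> y)" "j < dim_col (\<rho> x * \<rho> y)"
      then have ij: "i < n" "j < n" by (auto simp: \<rho>_def)
      obtain l where l: "l < n" "f l = y \<otimes> f j" using f_surj[of "y \<otimes> f j"] xy fc ij by auto
      have "(\<rho> x * \<rho> y) $$ (i,j) = (\<Sum>k\<in>{0..<n}. \<rho> x $$ (i,k) * \<rho> y $$ (k,j))"
        using ij by (intro mat_mult_index[of _ n n _ n]) (auto simp: \<rho>_def)
      also have "\<dots> = (\<Sum>k\<in>{0..<n}. if k = l then \<rho> x $$ (i,l) else 0)"
      proof (intro sum.cong refl)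
        fix k assume "k \<in> {0..<n}"
        then have "f k = y \<otimes> f j \<longleftrightarrow> k = l" using l f_inj[of k l] by simp
        then show "\<rho> x $$ (i,k) * \<rho> y $$ (k,j) = (if k = l then \<rho> x $$ (i,l) else 0)"
          using \<open>k \<in> {0..<n}\<close> ij l by (simp add: \<rho>_def)
      qed
      also have "\<dots> = \<rho> (x \<otimes> y) $$ (i,j)"
        using ij l xy fc by (simp add: \<rho>_def m_assoc)
      finally show "\<rho> (x \<otimes> y) $$ (i,j) = (\<rho> x * \<rho> y) $$ (i,j)" by simp
    qed (auto simp: \<rho>_def)
  qed
  note [simp] = rep_carrier[OF rep]
  let ?e = "H_projector n \<rho>"
  have expand: "?e * \<rho> x * ?e = mean_mat n n H (\<lambda>h. mean_mat n n H (\<lambda>k. \<rho> (h \<otimes> x \<otimes> k)))" if x: "x \<in> carrier G" for x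
  proof -
    have "?e * \<rho> x * ?e = mean_mat n n H (\<lambda>h. \<rho> h * \<rho> x) * ?e"
      unfolding H_projector_def using x by (simp add: mean_mat_mult[of _ n n])
    also have "\<dots> = mean_mat n n H (\<lambda>h. \<rho> h * \<rho> x * ?e)"
      using x by (intro mean_mat_mult) (auto simp: sq_carrier[where n=n])
    also have "\<dots> = mean_mat n n H (\<lambda>h. mean_mat n n H (\<lambda>k. \<rho> h * \<rho> x * \<rho> k))"
      unfolding H_projector_def using x
      by (intro mean_mat_cong mult_mean_mat) (auto simp: sq_carrier[where n=n])
    also have "\<dots> = mean_mat n n H (\<lambda>h. mean_mat n n H (\<lambda>k. \<rho> (h \<otimes> x \<otimes> k)))"
      using x by (intro mean_mat_cong) (simp add: rep_mult[OF rep])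
    finally show ?thesis .
  qed
  obtain a b where a: "a < n" "f a = inv g" and b: "b < n" "f b = \<one>"
    using f_surj g by (metis inv_closed one_closed)
  define N where "N x = {(h,k) \<in> H \<times> H. h \<otimes> x \<otimes> k = inv g}" for x
  have finN: "finite (N x)" for x by (rule finite_subset[of _ "H \<times> H"]) (auto simp: N_def)
  have entry: "(?e * \<rho> x * ?e) $$ (a,b) = of_nat (card (N x)) / (of_nat (card H))\<^sup>2" if x: "x \<in> carrier G" for x
  proof -
    have "(\<Sum>h\<in>H. \<Sum>k\<in>H. \<rho> (h \<otimes> x \<otimes> k) $$ (a,b)) = (\<Sum>p\<in>H \<times> H. if p \<in> N x then 1 else 0)"
      unfolding sum.cartesian_product
    proof (intro sum.cong refl)
      fix p assume "p \<in> H \<times> H"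
      then show "(case p of (h, k) \<Rightarrow> \<rho> (h \<otimes> x \<otimes> k) $$ (a,b)) = (if p \<in> N x then 1 else 0)"
        using a b x g by (cases p) (auto simp: \<rho>_def N_def split: if_splits)
    qed
    also have "\<dots> = of_nat (card (N x))"
    proof -
      have "H \<times> H \<inter> N x = N x" by (auto simp: N_def)
      then show ?thesis by (simp add: sum.inter_restrict[symmetric])
    qed
    finally show ?thesis
      unfolding expand[OF x] using a b
      by (simp add: mean_mat_index sum_divide_distrib[symmetric] power2_eq_square)
  qed
  have "(\<one>, \<one>) \<in> N (inv g)" using g subgroup.one_closed[OF subgroup_H] by (simp add: N_def)
  then have "card (N (inv g)) \<noteq> 0" using finN by (auto simp: card_eq_0_iff)
  then have "card (N (\<theta> g)) \<noteq> 0"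
    using twist_symmetricD[OF all[OF rep] g] entry[of "inv g"] entry[of "\<theta> g"] g by simp
  then obtain h k where hk: "h \<in> H" "k \<in> H" "h \<otimes> \<theta> g \<otimes> k = inv g"
    by (auto simp: N_def card_eq_0_iff)
  have "h \<otimes> \<theta> g \<otimes> k \<otimes> inv k = h \<otimes> \<theta> g" "inv h \<otimes> (h \<otimes> \<theta> g) = \<theta> g"
    using hk(1,2) g by (simp_all add: m_assoc m_assoc[of "inv h" h, symmetric])
  then have "inv h \<otimes> inv g \<otimes> inv k = \<theta> g"
    unfolding hk(3)[symmetric] using hk(1,2) g by (simp add: m_assoc)
  then show ?thesis using hk by (meson H_inv)
qed

end

section \<open>The equivalence\<close>

theorem theorem2:
  fixes G :: "('a, 'b) monoid_scheme" (structure)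
    and \<theta> :: "'a \<Rightarrow> 'a" and H :: "'a set"
  assumes "group G" and "finite (carrier G)"
    and "\<theta> \<in> iso G G" and "\<forall>g\<in>carrier G. \<theta> (\<theta> g) = g"
    and "subgroup H G" and "\<theta> ` H = H"
  shows "(gelfand_pair G H \<and>
          (\<forall>n \<pi>. irreducible_rep G n \<pi> \<and> distinguished H n \<pi> \<longrightarrow>
             rep_iso G n (\<pi> \<circ> \<theta>) n (dual_rep G \<pi>)))
     \<longleftrightarrow> (\<forall>g\<in>carrier G. \<exists>h\<^sub>1\<in>H. \<exists>h\<^sub>2\<in>H. h\<^sub>1 \<otimes> inv g \<otimes> h\<^sub>2 = \<theta> g)"
    (is "?gelfand \<and> ?dual \<longleftrightarrow> ?cosets")
proof -
  interpret symmetric_pair G \<theta> H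
    using assms by (simp add: symmetric_pair_def symmetric_pair_axioms_def)
  have rep: "representation G n \<pi>" if "irreducible_rep G n \<pi>" for n \<pi>
    using that by (simp add: irreducible_rep_def)
  show ?thesis
  proof
    assume "?gelfand \<and> ?dual"
    then have "twist_symmetric n \<pi>" if "irreducible_rep G n \<pi>" for n \<pi>
      using twist_symmetric_of_dual[OF rep[OF that]] that by (simp add: gelfand_pair_def)
    then show ?cosets
      using double_cosets_of_regular twist_symmetric_of_irreducibles by blast
  next
    assume ?cosets
    then have sym: "twist_symmetric n \<pi>" if "irreducible_rep G n \<pi>" for n \<pi>
      using double_cosets_imp_twist_symmetric[OF rep[OF that]] by blast
    then show "?gelfand \<and> ?dual"
      using dim_invariants_of_twist_symmetric[OF rep] dual_of_twist_symmetric[OF rep]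
      by (simp add: gelfand_pair_def)
  qed
qed

end
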